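(* Let $g$ be a complex constant with $g^2\neq 1$ (so that $c$ must vanish, $c=0$), and consider the reduced Gauss-Codazzi system with the isothermic constraint $q=r$, for functions $v,h,q$ of $\eta$ (prime $=d/d\eta$): $$\left(\eta\frac{v'}{v}\right)'-\frac{h^2}{2\eta^2}v+\frac{2q^2}{\eta^2 v}=0,\qquad -\eta v h'-2\eta^2 q'+(1+g)vh=0,\qquad -\eta^2 v h'-2\eta q'+2(1-g)q=0,$$ with the first integral $$K=\left(\eta\frac{v'}{v}+g\right)^2-\frac{h^2v}{\eta}-2hq-\frac{2hq}{\eta^2}-\frac{4q^2}{\eta v}.$$ The general solution of this system is given in terms of a sixth Painlevé function $V(X)$, with two constraints among its four parameters $\theta_j$, by $$X=\frac{1}{1-\eta^2},\qquad \frac{\eta h v}{2q}=\frac{V-X}{X},$$ $$\frac{d\log h}{dX}=\frac{1+g}{2(X-1)}-\frac{1-g}{2(V-X)},\qquad \frac{d\log q}{dX}=\frac{1}{X-1}-\frac{(1+g)V}{2X(X-1)},$$ $$hq=\frac{2(X-1)}{V(V-1)(V-X)}\left[\left(X(X-1)\frac{dV}{dX}+\frac{1-g}{2}V(V-1)\right)^2-\frac{K}{4}(V-X)^2\right],$$ where the parameters of the sixth Painlevé equation satisfied by $V(X)$ are $$(\theta_\infty^2,\theta_0^2,\theta_1^2,\theta_X^2)=\left(\left(\tfrac{1+g}{2}\right)^2,\ \tfrac{K}{4},\ \tfrac{K}{4},\ \left(\tfrac{1-g}{2}\right)^2\right).$$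
   Context: The Gauss-Codazzi system with $c=0$, for complex functions $u,H,Q,R$ (with $R$ standing for $\overline Q$) of the independent complex variables $z,\bar z$, is $$u_{z\bar z}+\tfrac12 H^2e^u-2QRe^{-u}=0,\qquad Q_{\bar z}=\tfrac12 H_ze^u,\qquad R_z=\tfrac12 H_{\bar z}e^u.$$ The ODE system in the claim arises from it by the symmetry reduction $$\eta=\frac{g_1(z)}{g_2(\bar z)},\quad e^u=g_1^{2g}g_1'g_2'\,v(\eta),\quad H=g_1^{-1-g}h(\eta),\quad Q=g_1^{g-1}g_1'^2\,q(\eta),\quad R=g_1^{g-1}g_2'^2\,r(\eta),$$ with $g_1,g_2$ arbitrary functions of $z$ and $\bar z$ respectively, after imposing the constraint $q=r$ (equivalent to the isothermic constraint $Q=\overline Q=R$ under a suitable choice of $g_1,g_2$). The sixth Painlevé equation with parameters $\theta_\infty^2,\theta_0^2,\theta_1^2,\theta_X^2$ is (prime $=d/dX$) $$V''=\frac12\left[\frac1V+\frac1{V-1}+\frac1{V-X}\right]V'^2-\left[\frac1X+\frac1{X-1}+\frac1{V-X}\right]V'$$ $$+\frac{V(V-1)(V-X)}{2X^2(X-1)^2}\left[\theta_\infty^2-\theta_0^2\frac{X}{V^2}+\theta_1^2\frac{X-1}{(V-1)^2}+(1-\theta_X^2)\frac{X(X-1)}{(V-X)^2}\right].$$ A sixth Painlevé function is a solution of this equation.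
   Formalization: In the hq formula the coefficient (1-g)/2 of V(V-1) is corrected to -(1+g)/2: as printed it fails, e.g. for g=0 and data v=h=q=1, v'=0 at η=2. The trivial solution h=q=0 and isolated zeros of h, q, V, V-1 are excluded, and V(X) is taken where X is injective in η. *)

theory Defs
  imports "HOL-Complex_Analysis.Complex_Analysis"
begin

text \<open>
  All functions are single-valued analytic branches on open subsets of the complex plane. The
  parameters of the sixth Painleve equation enter only through their squares, so the arguments
  \<open>a\<close>, \<open>b\<close>, \<open>c\<close>, \<open>d\<close> below are the four squares, in the order infinity, 0, 1, X.
\<close>

definition PVI_rhs ::
    "complex \<Rightarrow> complex \<Rightarrow> complex \<Rightarrow> complex \<Rightarrow> complex \<Rightarrow> complex \<Rightarrow> complex \<Rightarrow> complex" where
  "PVI_rhs a b c d X V V' =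
     1/2 * (1/V + 1/(V - 1) + 1/(V - X)) * V'^2
     - (1/X + 1/(X - 1) + 1/(V - X)) * V'
     + V * (V - 1) * (V - X) / (2 * X^2 * (X - 1)^2)
       * (a - b * (X / V^2) + c * ((X - 1) / (V - 1)^2)
          + (1 - d) * (X * (X - 1) / (V - X)^2))"

definition PVI_function ::
    "complex \<Rightarrow> complex \<Rightarrow> complex \<Rightarrow> complex \<Rightarrow> complex set \<Rightarrow> (complex \<Rightarrow> complex) \<Rightarrow> bool" where
  "PVI_function a b c d S V \<longleftrightarrow>
     open S \<and> 0 \<notin> S \<and> 1 \<notin> S \<and> V holomorphic_on S \<and>
     (\<forall>X\<in>S. V X \<noteq> 0 \<and> V X \<noteq> 1 \<and> V X \<noteq> X \<and>
        deriv (deriv V) X = PVI_rhs a b c d X (V X) (deriv V X))"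

definition reduced_GC_solution ::
    "complex \<Rightarrow> complex set \<Rightarrow> (complex \<Rightarrow> complex) \<Rightarrow> (complex \<Rightarrow> complex) \<Rightarrow> (complex \<Rightarrow> complex) \<Rightarrow> bool" where
  "reduced_GC_solution g D v h q \<longleftrightarrow>
     open D \<and> 0 \<notin> D \<and> v holomorphic_on D \<and> h holomorphic_on D \<and> q holomorphic_on D \<and>
     (\<forall>\<eta>\<in>D. v \<eta> \<noteq> 0 \<and>
        deriv (\<lambda>s. s * (deriv v s / v s)) \<eta>
          - (h \<eta>)^2 / (2 * \<eta>^2) * v \<eta> + 2 * (q \<eta>)^2 / (\<eta>^2 * v \<eta>) = 0 \<and>
        - (\<eta> * v \<eta> * deriv h \<eta>) - 2 * \<eta>^2 * deriv q \<eta> + (1 + g) * v \<eta> * h \<eta> = 0 \<and>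
        - (\<eta>^2 * v \<eta> * deriv h \<eta>) - 2 * \<eta> * deriv q \<eta> + 2 * (1 - g) * q \<eta> = 0)"

definition first_integral ::
    "complex \<Rightarrow> (complex \<Rightarrow> complex) \<Rightarrow> (complex \<Rightarrow> complex) \<Rightarrow> (complex \<Rightarrow> complex) \<Rightarrow> complex \<Rightarrow> complex" where
  "first_integral g v h q \<eta> =
     (\<eta> * (deriv v \<eta> / v \<eta>) + g)^2 - (h \<eta>)^2 * v \<eta> / \<eta> - 2 * h \<eta> * q \<eta>
       - 2 * h \<eta> * q \<eta> / \<eta>^2 - 4 * (q \<eta>)^2 / (\<eta> * v \<eta>)"

definition Xmap :: "complex \<Rightarrow> complex" where
  "Xmap \<eta> = 1 / (1 - \<eta>^2)"

text \<open>
  For a function \<open>f\<close> of \<open>\<eta>\<close>, the derivative of \<open>log f\<close> with respect to \<open>X\<close>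
  (chain rule, no choice of a branch of the logarithm or of \<open>\<eta>(X)\<close>).
\<close>

definition dlog_dX :: "(complex \<Rightarrow> complex) \<Rightarrow> complex \<Rightarrow> complex" where
  "dlog_dX f \<eta> = (deriv f \<eta> / f \<eta>) / deriv Xmap \<eta>"

text \<open>
  The coefficient of \<open>V (V - 1)\<close> must be \<open>-(1 + g)/2\<close>, not \<open>(1 - g)/2\<close> as sometimes
  printed: inserting \<open>v = 2 q (V - X) / (X \<eta> h)\<close> and the two logarithmic derivatives in
  \<^const>\<open>first_integral\<close> gives
  \<open>\<eta> v'/v + g = 2 (X (X - 1) V' - (1 + g)/2 V (V - 1)) / (V - X)\<close>.
\<close>

definition hq_of_V :: "complex \<Rightarrow> complex \<Rightarrow> (complex \<Rightarrow> complex) \<Rightarrow> complex \<Rightarrow> complex" where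
  "hq_of_V g K V X =
     2 * (X - 1) / (V X * (V X - 1) * (V X - X))
       * ((X * (X - 1) * deriv V X - (1 + g) / 2 * (V X * (V X - 1)))^2
          - K / 4 * (V X - X)^2)"

definition given_by ::
    "complex \<Rightarrow> complex \<Rightarrow> (complex \<Rightarrow> complex) \<Rightarrow> complex set \<Rightarrow>
     (complex \<Rightarrow> complex) \<Rightarrow> (complex \<Rightarrow> complex) \<Rightarrow> (complex \<Rightarrow> complex) \<Rightarrow> bool" where
  "given_by g K V D v h q \<longleftrightarrow>
     v holomorphic_on D \<and> h holomorphic_on D \<and> q holomorphic_on D \<and>
     (\<forall>\<eta>\<in>D. v \<eta> \<noteq> 0 \<and> h \<eta> \<noteq> 0 \<and> q \<eta> \<noteq> 0 \<and>
        (let X = Xmap \<eta> in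
          \<eta> * h \<eta> * v \<eta> / (2 * q \<eta>) = (V X - X) / X \<and>
          dlog_dX h \<eta> = (1 + g) / (2 * (X - 1)) - (1 - g) / (2 * (V X - X)) \<and>
          dlog_dX q \<eta> = 1 / (X - 1) - (1 + g) * V X / (2 * X * (X - 1)) \<and>
          h \<eta> * q \<eta> = hq_of_V g K V X))"

end

theory Submission
  imports Defs
begin

text \<open>
  The auxiliary function \<open>P = 2 (X (X - 1) V' - (1 + g)/2 V (V - 1)) / (V - X)\<close> turns the sixth
  Painleve equation into a first-order system: for these parameters it is equivalent to
  \<open>P' = (P\<^sup>2 - K) (V\<^sup>2 - 2 X V + X) / (4 X (X - 1) V (V - 1))\<close>. Under the change of variables
  \<open>P = \<eta> v'/v + g\<close>, so this is the first reduced Gauss-Codazzi equation once the first integral,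
  which reads \<open>P\<^sup>2 - K = 2 h q V (V - 1) / ((X - 1) (V - X))\<close>, is used to eliminate \<open>h q\<close>. The
  other two equations are linear in \<open>h'\<close> and \<open>q'\<close>, and solving them gives the logarithmic
  derivatives. Finally \<open>P\<^sup>2 - K\<close> satisfies a linear homogeneous equation along a solution, hence
  vanishes identically or nowhere; this lets \<open>q\<close> be obtained as the exponential of a primitive and
  \<open>h\<close> as a quotient by it.
\<close>

section \<open>The sixth Painleve equation as a first-order equation for \<open>P\<close>\<close>

text \<open>Multiplied by \<open>2 * m^2 * n * e\<close>, the defect of the Painleve equation
  becomes a nonzero multiple of the defect of the first-order equation, so the two vanish together.
  \<open>V1\<close>, \<open>V2\<close>, \<open>T\<close> stand for \<open>V'\<close>,
  \<open>V''\<close>, \<open>P'\<close>; the hypotheses \<open>P\<close> and \<open>T\<close> are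
  the definition of \<open>P\<close> and its derivative, cleared of denominators. The constant
  \<open>s\<close> will be \<open>(1 + g) / 2\<close>.\<close>

lemma PVI_hamiltonian_iff:
  fixes X V V1 V2 P T s K :: complex
  assumes nz: "X \<noteq> 0" "X \<noteq> 1" "V \<noteq> 0" "V \<noteq> 1" "V \<noteq> X"
    and P: "P * (V - X) = 2 * (X * (X - 1) * V1 - s * (V * (V - 1)))"
    and T: "T * (V - X) + P * (V1 - 1)
            = 2 * ((2 * X - 1) * V1 + X * (X - 1) * V2 - s * ((2 * V - 1) * V1))"
  shows "V2 = PVI_rhs (s^2) (K/4) (K/4) ((1 - s)^2) X V V1 \<longleftrightarrow>
         T = (P^2 - K) * (V^2 - 2*X*V + X) / (4 * (X * (X - 1)) * (V * (V - 1)))"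
proof -
  define m n e where "m = X * (X - 1)" and "n = V * (V - 1)" and "e = V - X"
  define y where "y = V^2 - 2*X*V + X"
  define N where "N = m * V1"
  have nz': "m \<noteq> 0" "n \<noteq> 0" "e \<noteq> 0" "V - 1 \<noteq> 0" "X - 1 \<noteq> 0"
    using nz by (auto simp: m_def n_def e_def)
  \<comment> \<open>One polynomial \<open>y\<close> is the remainder in both relations. Hence the
    terms of the defect in \<open>N^2\<close>, \<open>n * N\<close> and \<open>n^2\<close> end up
    with coefficients \<open>- y\<close>, \<open>2 * s * y\<close> and \<open>- s^2 * y\<close>, and
    complete to the square \<open>- y * (e * P)^2 / 4\<close>.\<close>
  have r1: "(2 * V - 1) * e = n + y" and r2: "e^2 = y + m"
    by (simp_all add: n_def e_def y_def m_def power2_eq_square algebra_simps)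
  have rP: "e * P = 2 * (N - s * n)"
    using P by (simp add: N_def m_def n_def e_def mult.commute)
  have rT: "2 * m * V2 = T * e + P * (V1 - 1) - 2 * (2*X - 1) * V1 + 2 * s * (2*V - 1) * V1"
    using T by (simp add: m_def e_def algebra_simps)
  have a1: "1/V + 1/(V - 1) + 1/(V - X) = ((2*V - 1) * e + n) / (n * e)"
    using nz nz' by (simp add: n_def e_def divide_simps)
  have a2: "1/X + 1/(X - 1) + 1/(V - X) = ((2*X - 1) * e + m) / (m * e)"
    using nz nz' by (simp add: m_def e_def divide_simps)
  \<comment> \<open>The two constraints on the parameters enter here: equal squares at
    \<open>0\<close> and \<open>1\<close> merge two double poles into \<open>y / n^2\<close>, and
    the squares \<open>s^2\<close> and \<open>(1 - s)^2\<close> are tied by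
    \<open>1 - (1 - s)^2 = 2 * s - s^2\<close>.\<close>
  have a3: "s^2 - (K/4) * (X / V^2) + (K/4) * ((X - 1) / (V - 1)^2)
              + (1 - (1 - s)^2) * (X * (X - 1) / (V - X)^2)
            = s^2 - (K/4) * (y / n^2) + (2 * s - s^2) * (m / e^2)"
  proof -
    have b1: "y / n^2 = X / V^2 - (X - 1) / (V - 1)^2"
      by (simp add: nz nz' n_def y_def divide_simps) algebra
    have b2: "1 - (1 - s)^2 = 2 * s - s^2" by algebra
    show ?thesis
      unfolding b1 b2 m_def e_def by (simp add: right_diff_distrib)
  qed
  have rhs: "PVI_rhs (s^2) (K/4) (K/4) ((1 - s)^2) X V V1 * (2 * m^2 * n * e)
      = ((2*V - 1) * e + n) * N^2 - 2 * ((2*X - 1) * e + m) * n * N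
        + n^2 * e^2 * s^2 - (K/4) * y * e^2 + (2 * s - s^2) * m * n^2"
  proof -
    have eq: "(1/2 * (A / (n * e)) * V1^2 - B / (m * e) * V1 + n * e / (2 * m^2) * Q) * (2 * m^2 * n * e)
        = A * (m * V1)^2 - 2 * B * n * (m * V1) + n^2 * e^2 * Q" for A B Q
      by (simp add: nz' field_simps power2_eq_square)
    have exp: "PVI_rhs (s^2) (K/4) (K/4) ((1 - s)^2) X V V1
        = 1/2 * (((2*V - 1) * e + n) / (n * e)) * V1^2 - ((2*X - 1) * e + m) / (m * e) * V1
          + n * e / (2 * m^2) * (s^2 - (K/4) * (y / n^2) + (2 * s - s^2) * (m / e^2))"
      unfolding PVI_rhs_def a1 a2 a3 by (simp only: m_def n_def e_def power_mult_distrib mult.assoc)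
    have "n^2 * e^2 * (s^2 - (K/4) * Y + (2 * s - s^2) * Z)
        = n^2 * e^2 * s^2 - (K/4) * (n^2 * Y) * e^2 + (2 * s - s^2) * (e^2 * Z) * n^2" for Y Z
      by algebra
    from this [of "y / n^2" "m / e^2"] show ?thesis
      unfolding exp eq N_def using nz'(2,3) by simp
  qed
  have "V2 * (2 * m^2 * n * e)
      = m * n * e * (T * e + P * (V1 - 1) - 2 * (2*X - 1) * V1 + 2 * s * (2*V - 1) * V1)"
    unfolding rT [symmetric] by (simp add: power2_eq_square)
  also have "\<dots> = e^2 * (m * n * T) + n * (e * P) * (N - m) - 2 * (2*X - 1) * n * e * N
                 + 2 * s * ((2*V - 1) * e) * n * N"
    unfolding N_def by algebra
  finally have lhs: "V2 * (2 * m^2 * n * e) = \<dots>" .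
  have "(V2 - PVI_rhs (s^2) (K/4) (K/4) ((1 - s)^2) X V V1) * (2 * m^2 * n * e)
      = e^2 * (m * n * T) - y * ((e * P)^2 - K * e^2) / 4"
    unfolding left_diff_distrib [of V2] lhs rhs rP r1 r2 by algebra
  also have "\<dots> = e^2 * (m * n * T - y * (P^2 - K) / 4)"
    by algebra
  finally have key: "(V2 - PVI_rhs (s^2) (K/4) (K/4) ((1 - s)^2) X V V1) * (2 * m^2 * n * e)
      = e^2 * (m * n * T - y * (P^2 - K) / 4)" .
  have "V2 = PVI_rhs (s^2) (K/4) (K/4) ((1 - s)^2) X V V1 \<longleftrightarrow>
        (V2 - PVI_rhs (s^2) (K/4) (K/4) ((1 - s)^2) X V V1) * (2 * m^2 * n * e) = 0"
    using nz'(1-3) by simp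
  also have "\<dots> \<longleftrightarrow> m * n * T = y * (P^2 - K) / 4"
    unfolding key using nz'(3) by simp
  also have "\<dots> \<longleftrightarrow> T = (P^2 - K) * y / (4 * m * n)"
    using nz'(1,2) by (simp add: eq_divide_eq) (simp add: mult_ac)
  finally show ?thesis
    by (simp add: y_def m_def n_def mult.assoc)
qed

section \<open>Pointwise translation between the variables \<open>\<eta>\<close> and
  \<open>X\<close>\<close>

lemma Xmap_nz:
  assumes "\<eta> \<noteq> 0" "\<eta>^2 \<noteq> 1"
  shows "Xmap \<eta> \<noteq> 0" "Xmap \<eta> \<noteq> 1" "Xmap \<eta> - 1 = \<eta>^2 * Xmap \<eta>" "Xmap \<eta> * (1 - \<eta>^2) = 1"
  using assms by (auto simp: Xmap_def divide_simps)

lemma has_field_derivative_Xmap: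
  assumes "\<eta>^2 \<noteq> 1"
  shows "(Xmap has_field_derivative 2 * \<eta> * (Xmap \<eta>)^2) (at \<eta>)"
  unfolding Xmap_def [abs_def]
  by (rule derivative_eq_intros refl | use assms in \<open>simp add: power2_eq_square\<close>)+

text \<open>The combinations \<open>?A - \<eta> * ?B\<close> and \<open>\<eta> * ?A - ?B\<close>
  remove \<open>q'\<close> and \<open>h'\<close> respectively, and passing to them is invertible as
  \<open>\<eta>^2 \<noteq> 1\<close>. Each then contains a single derivative; the divisor
  \<open>2 * \<eta> * X^2\<close> is the value of \<open>dX/d\<eta>\<close>.\<close>

lemma linear_equations_iff_dlog:
  fixes \<eta> g v h q h' q' V X :: complex
  assumes nz: "\<eta> \<noteq> 0" "\<eta>^2 \<noteq> 1" "v \<noteq> 0" "h \<noteq> 0" "q \<noteq> 0"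
    and X: "X = Xmap \<eta>" and V: "\<eta> * h * v / (2 * q) = (V - X) / X"
  shows "- (\<eta> * v * h') - 2 * \<eta>^2 * q' + (1 + g) * v * h = 0 \<and>
         - (\<eta>^2 * v * h') - 2 * \<eta> * q' + 2 * (1 - g) * q = 0 \<longleftrightarrow>
         h' / h / (2 * \<eta> * X^2) = (1 + g) / (2 * (X - 1)) - (1 - g) / (2 * (V - X)) \<and>
         q' / q / (2 * \<eta> * X^2) = 1 / (X - 1) - (1 + g) * V / (2 * X * (X - 1))"
    (is "?A = 0 \<and> ?B = 0 \<longleftrightarrow> ?C \<and> ?D")
proof -
  define U where "U = \<eta> * h * v / (2 * q)"
  have U: "\<eta> * h * v = 2 * q * U" "U \<noteq> 0"
    using nz by (auto simp: U_def)
  have X0: "X \<noteq> 0" "X - 1 = \<eta>^2 * X" "X * (1 - \<eta>^2) = 1"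
    using Xmap_nz[OF nz(1,2)] X by auto
  have VU: "V - X = X * U" "V = X * (1 + U)"
    using V X0 by (auto simp: U_def field_simps)
  have "?A = 0 \<and> ?B = 0 \<longleftrightarrow> ?A - \<eta> * ?B = 0 \<and> \<eta> * ?A - ?B = 0"
  proof -
    have "a = 0 \<and> b = 0 \<longleftrightarrow> a - \<eta> * b = 0 \<and> \<eta> * a - b = 0" for a b :: complex
    proof
      assume *: "a - \<eta> * b = 0 \<and> \<eta> * a - b = 0"
      have "(1 - \<eta>^2) * a = (a - \<eta> * b) - \<eta> * (\<eta> * a - b)"
           "(1 - \<eta>^2) * b = \<eta> * (a - \<eta> * b) - (\<eta> * a - b)" by algebra+
      then have "(1 - \<eta>^2) * a = 0" "(1 - \<eta>^2) * b = 0" unfolding conjunct1[OF *] conjunct2[OF *] by simp_all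
      then show "a = 0 \<and> b = 0" using nz(2) by simp
    qed simp
    then show ?thesis .
  qed
  also have "?A - \<eta> * ?B = 0 \<longleftrightarrow> ?C"
  proof -
    have "?C \<longleftrightarrow> h' * U * \<eta> = h * X * ((1 + g) * U - \<eta>^2 * (1 - g))"
      unfolding VU X0(2) using nz U X0(1) by (simp add: divide_simps) algebra
    also have "\<dots> \<longleftrightarrow> (h' * U * \<eta>) * (1 - \<eta>^2) = h * ((1 + g) * U - \<eta>^2 * (1 - g))"
      using X0 nz(2) by algebra
    also have "\<dots> \<longleftrightarrow> (h' * U * \<eta>) * (1 - \<eta>^2) * (2 * q) = h * ((1 + g) * U - \<eta>^2 * (1 - g)) * (2 * q)"
      using nz by simp
    also have "\<dots> \<longleftrightarrow> \<eta> * h * (?A - \<eta> * ?B) = 0"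
      using U by algebra
    finally show ?thesis using nz by simp
  qed
  also have "\<eta> * ?A - ?B = 0 \<longleftrightarrow> ?D"
  proof -
    have "?D \<longleftrightarrow> q' * \<eta> = q * X * ((1 - g) - (1 + g) * U)"
      unfolding VU X0(2) using nz U X0(1) by (simp add: divide_simps) algebra
    also have "\<dots> \<longleftrightarrow> (q' * \<eta>) * (1 - \<eta>^2) = q * ((1 - g) - (1 + g) * U)"
      using X0 nz(2) by algebra
    also have "\<dots> \<longleftrightarrow> (\<eta> * ?A - ?B) = 0"
      using U by algebra
    finally show ?thesis by simp
  qed
  finally show ?thesis .
qed

text \<open>The quantity \<open>P\<close> of the idea above. Multiplied by
  \<open>(V - X) / 2\<close> it is the base of the square in \<open>hq_of_V\<close>, so the bracket
  there equals \<open>(P^2 - K) * (V - X)^2 / 4\<close>.\<close>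

definition GC_momentum :: "complex \<Rightarrow> (complex \<Rightarrow> complex) \<Rightarrow> complex \<Rightarrow> complex" where
  "GC_momentum g V X =
     2 * (X * (X - 1) * deriv V X - (1 + g) / 2 * (V X * (V X - 1))) / (V X - X)"

lemma has_field_derivative_GC_momentum:
  assumes "open S" "V holomorphic_on S" "X \<in> S" "V X \<noteq> X"
  shows "(GC_momentum g V has_field_derivative
            (2 * ((2 * X - 1) * deriv V X + X * (X - 1) * deriv (deriv V) X
                  - (1 + g) / 2 * ((2 * V X - 1) * deriv V X))
             - GC_momentum g V X * (deriv V X - 1)) / (V X - X)) (at X)"
proof -
  have d: "(V has_field_derivative deriv V X) (at X)"
          "(deriv V has_field_derivative deriv (deriv V) X) (at X)"
    using assms by (auto intro!: holomorphic_derivI holomorphic_deriv)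
  have nz: "V X - X \<noteq> 0" using assms by simp
  show ?thesis
    unfolding GC_momentum_def [abs_def]
    by (rule derivative_eq_intros d refl nz | use nz in \<open>simp add: field_simps power2_eq_square\<close>)+
qed

text \<open>The case \<open>s = (1 + g) / 2\<close> of \<open>PVI_hamiltonian_iff\<close>, where
  \<open>1 - s = (1 - g) / 2\<close>. It is an equivalence because one implication builds solutions
  from \<open>V\<close> and the other shows that a \<open>V\<close> built from a solution is a
  Painleve function.\<close>

lemma PVI_iff_momentum_equation:
  fixes g K :: complex
  assumes "open S" "V holomorphic_on S" "X \<in> S" "X \<noteq> 0" "X \<noteq> 1" "V X \<noteq> 0" "V X \<noteq> 1" "V X \<noteq> X"
  shows "deriv (deriv V) X
           = PVI_rhs (((1 + g) / 2)^2) (K / 4) (K / 4) (((1 - g) / 2)^2) X (V X) (deriv V X)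
         \<longleftrightarrow> (GC_momentum g V has_field_derivative
               ((GC_momentum g V X)^2 - K) * ((V X)^2 - 2 * X * V X + X)
                 / (4 * (X * (X - 1)) * (V X * (V X - 1)))) (at X)"
proof -
  define T where "T = deriv (GC_momentum g V) X"
  have D: "(GC_momentum g V has_field_derivative T) (at X)"
    using has_field_derivative_GC_momentum[OF assms(1-3,8)]
    unfolding T_def by (metis DERIV_imp_deriv)
  have T: "T = (2 * ((2 * X - 1) * deriv V X + X * (X - 1) * deriv (deriv V) X
                  - (1 + g) / 2 * ((2 * V X - 1) * deriv V X))
             - GC_momentum g V X * (deriv V X - 1)) / (V X - X)"
    using D has_field_derivative_GC_momentum[OF assms(1-3,8)] DERIV_unique by blast
  have "deriv (deriv V) X
           = PVI_rhs (((1 + g) / 2)^2) (K / 4) (K / 4) ((1 - (1 + g) / 2)^2) X (V X) (deriv V X)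
        \<longleftrightarrow> T = ((GC_momentum g V X)^2 - K) * ((V X)^2 - 2 * X * V X + X)
                 / (4 * (X * (X - 1)) * (V X * (V X - 1)))"
    using assms T by (intro PVI_hamiltonian_iff) (auto simp: GC_momentum_def)
  also have "1 - (1 + g) / 2 = (1 - g) / 2" by (simp add: field_simps)
  finally show ?thesis using D by (metis DERIV_unique)
qed

text \<open>Inserting \<open>v = 2 * q * e / (\<eta> * h * X)\<close> makes every term other than
  \<open>P^2\<close> a multiple of \<open>h * q\<close>, so the first integral is linear in
  \<open>h * q\<close> and can be solved for it. The second claim feeds that value into the terms of
  the first reduced equation that carry no derivative; its last factor is again
  \<open>dX/d\<eta>\<close>.\<close>

lemma first_integral_iff_hq:
  fixes \<eta> v h q P K V X :: complex
  assumes nz: "\<eta> \<noteq> 0" "\<eta>^2 \<noteq> 1" "v \<noteq> 0" "h \<noteq> 0" "q \<noteq> 0" "V \<noteq> 0" "V \<noteq> 1"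
    and X: "X = Xmap \<eta>" and V: "\<eta> * h * v / (2 * q) = (V - X) / X"
  shows "P^2 - h^2 * v / \<eta> - 2 * h * q - 2 * h * q / \<eta>^2 - 4 * q^2 / (\<eta> * v) = K \<longleftrightarrow>
         h * q = 2 * (X - 1) / (V * (V - 1) * (V - X)) * ((P * (V - X) / 2)^2 - K / 4 * (V - X)^2)"
    (is "?L \<longleftrightarrow> ?R")
    and "P^2 - h^2 * v / \<eta> - 2 * h * q - 2 * h * q / \<eta>^2 - 4 * q^2 / (\<eta> * v) = K \<Longrightarrow>
         h^2 / (2 * \<eta>^2) * v - 2 * q^2 / (\<eta>^2 * v)
         = (P^2 - K) * (V^2 - 2 * X * V + X) / (4 * (X * (X - 1)) * (V * (V - 1))) * (2 * \<eta> * X^2)"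
proof -
  define e where "e = V - X"
  have X0: "X \<noteq> 0" "X - 1 = \<eta>^2 * X" "X * (1 - \<eta>^2) = 1" "X \<noteq> 1"
    using Xmap_nz[OF nz(1,2)] X by auto
  have v: "v = 2 * q * e / (\<eta> * h * X)"
    using V nz X0 by (simp add: e_def field_simps)
  have e0: "e \<noteq> 0" using v nz by auto
  have Ve: "V = X + e" by (simp add: e_def)
  \<comment> \<open>The four terms collapse because their common numerator factors as
    \<open>(e + X) * (e + \<eta>^2 * X)\<close>, which is \<open>V * (V - 1)\<close>.\<close>
  have S: "h^2 * v / \<eta> + 2 * h * q + 2 * h * q / \<eta>^2 + 4 * q^2 / (\<eta> * v)
           = 2 * (h * q) * (V * (V - 1)) / (e * (X - 1))"
  proof -
    have "h^2 * v / \<eta> + 2 * h * q + 2 * h * q / \<eta>^2 + 4 * q^2 / (\<eta> * v)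
         = 2 * (h * q) * (e + X) * (e + \<eta>^2 * X) / (e * (\<eta>^2 * X))"
      unfolding v by (simp add: nz X0(1) e0 divide_simps) algebra
    also have "e + \<eta>^2 * X = V - 1" unfolding X0(2)[symmetric] e_def by simp
    finally show ?thesis by (simp add: Ve X0(2)[symmetric] mult.assoc add.commute)
  qed
  have n: "X - 1 \<noteq> 0" "V - 1 \<noteq> 0" using X0 nz by auto
  have "?L \<longleftrightarrow> P^2 - K = 2 * (h * q) * (V * (V - 1)) / (e * (X - 1))"
    unfolding S [symmetric] by (auto simp: algebra_simps)
  also have "\<dots> \<longleftrightarrow> h * q = (P^2 - K) * (e * (X - 1)) / (2 * (V * (V - 1)))"
    using n nz e0 by (auto simp: divide_simps mult_ac)
  finally have L: "?L \<longleftrightarrow> h * q = (P^2 - K) * (e * (X - 1)) / (2 * (V * (V - 1)))" .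
  moreover have "2 * (X - 1) / (V * (V - 1) * (V - X)) * ((P * (V - X) / 2)^2 - K / 4 * (V - X)^2)
       = (P^2 - K) * (e * (X - 1)) / (2 * (V * (V - 1)))"
    unfolding e_def[symmetric]
    by (simp add: n nz e0 divide_simps) algebra
  ultimately show "?L \<longleftrightarrow> ?R" by simp
  assume ?L
  then have hq: "h * q = (P^2 - K) * (e * (X - 1)) / (2 * (V * (V - 1)))" using L by simp
  have "h^2 / (2 * \<eta>^2) * v - 2 * q^2 / (\<eta>^2 * v)
        = h * q * (e^2 - X * (X - 1)) / (\<eta> * (e * (X - 1)))"
    unfolding v X0(2) by (simp add: nz X0(1) e0 divide_simps) algebra
  also have "e^2 - X * (X - 1) = V^2 - 2 * X * V + X"
    by (simp add: e_def power2_eq_square algebra_simps)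
  also have "h * q * (V^2 - 2 * X * V + X) / (\<eta> * (e * (X - 1)))
    = (P^2 - K) * (V^2 - 2 * X * V + X) / (2 * \<eta> * (V * (V - 1)))"
    unfolding hq using n e0 nz by (simp add: divide_simps)
  also have "\<dots> = (P^2 - K) * (V^2 - 2 * X * V + X) / (4 * (X * (X - 1)) * (V * (V - 1))) * (2 * \<eta> * X^2)"
    unfolding X0(2) by (simp add: n nz e0 X0(1) divide_simps) (simp add: power2_eq_square algebra_simps)
  finally show "h^2 / (2 * \<eta>^2) * v - 2 * q^2 / (\<eta>^2 * v)
         = (P^2 - K) * (V^2 - 2 * X * V + X) / (4 * (X * (X - 1)) * (V * (V - 1))) * (2 * \<eta> * X^2)" .
qed

text \<open>Differentiating \<open>\<eta> * h * v * X = 2 * q * (V - X)\<close> in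
  \<open>\<eta>\<close> expresses \<open>v'/v\<close> through \<open>h'/h\<close>,
  \<open>q'/q\<close> and \<open>V'\<close>; inserting the prescribed logarithmic derivatives leaves
  \<open>V'\<close> as the only derivative. Both directions of the correspondence call on
  this.\<close>

lemma dlog_v_eq_momentum:
  assumes D: "open D" "\<eta> \<in> D" "v holomorphic_on D" "h holomorphic_on D" "q holomorphic_on D"
    and nz: "\<And>s. s \<in> D \<Longrightarrow> q s \<noteq> 0" "\<And>s. s \<in> D \<Longrightarrow> Xmap s \<noteq> 0"
       "\<eta> \<noteq> 0" "\<eta>^2 \<noteq> 1" "v \<eta> \<noteq> 0" "h \<eta> \<noteq> 0"
    and X: "X = Xmap \<eta>" and V1: "(V has_field_derivative deriv V X) (at X)"
    and U: "\<And>s. s \<in> D \<Longrightarrow> s * h s * v s / (2 * q s) = (V (Xmap s) - Xmap s) / Xmap s"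
    and dh: "deriv h \<eta> / h \<eta> / (2 * \<eta> * X^2) = (1 + g) / (2 * (X - 1)) - (1 - g) / (2 * (V X - X))"
    and dq: "deriv q \<eta> / q \<eta> / (2 * \<eta> * X^2) = 1 / (X - 1) - (1 + g) * V X / (2 * X * (X - 1))"
  shows "\<eta> * (deriv v \<eta> / v \<eta>) + g = GC_momentum g V X"
proof -
  have X0: "X \<noteq> 0" "X - 1 = \<eta>^2 * X" "X * (1 - \<eta>^2) = 1" "X \<noteq> 1"
    using Xmap_nz[OF nz(3,4)] X by auto
  define e where "e = V X - X"
  note ders = D(3-5)[THEN holomorphic_derivI, OF D(1,2)] has_field_derivative_Xmap[OF nz(4)]
  have VX: "((\<lambda>s. V (Xmap s)) has_field_derivative deriv V X * (2 * \<eta> * X^2)) (at \<eta>)"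
    using DERIV_chain2[OF V1[unfolded X] has_field_derivative_Xmap[OF nz(4)]] X by simp
  have 1: "((\<lambda>s. s * h s * v s * Xmap s) has_field_derivative
      h \<eta> * v \<eta> * X + \<eta> * deriv h \<eta> * v \<eta> * X + \<eta> * h \<eta> * deriv v \<eta> * X
       + \<eta> * h \<eta> * v \<eta> * (2 * \<eta> * X^2)) (at \<eta>)"
    by (rule derivative_eq_intros ders refl | simp add: X algebra_simps)+
  have 2: "((\<lambda>s. 2 * q s * (V (Xmap s) - Xmap s)) has_field_derivative
      2 * deriv q \<eta> * e + 2 * q \<eta> * ((deriv V X - 1) * (2 * \<eta> * X^2))) (at \<eta>)"
    by (rule derivative_eq_intros ders VX refl | simp add: X e_def algebra_simps)+
  have eq: "s * h s * v s * Xmap s = 2 * q s * (V (Xmap s) - Xmap s)" if "s \<in> D" for s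
    using U[OF that] nz(1,2)[OF that] by (simp add: field_simps)
  have "((\<lambda>s. 2 * q s * (V (Xmap s) - Xmap s)) has_field_derivative
      h \<eta> * v \<eta> * X + \<eta> * deriv h \<eta> * v \<eta> * X + \<eta> * h \<eta> * deriv v \<eta> * X
       + \<eta> * h \<eta> * v \<eta> * (2 * \<eta> * X^2)) (at \<eta>)"
    using has_field_derivative_transform_within_open[OF 1 D(1,2) eq] .
  then have main: "h \<eta> * v \<eta> * X + \<eta> * deriv h \<eta> * v \<eta> * X + \<eta> * h \<eta> * deriv v \<eta> * X
       + \<eta> * h \<eta> * v \<eta> * (2 * \<eta> * X^2)
     = 2 * deriv q \<eta> * e + 2 * q \<eta> * ((deriv V X - 1) * (2 * \<eta> * X^2))"
    using 2 DERIV_unique by blast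
  have q0: "q \<eta> \<noteq> 0" using nz D by auto
  have v: "\<eta> * h \<eta> * v \<eta> * X = 2 * q \<eta> * e" using eq[OF D(2)] X e_def by simp
  have e0: "e \<noteq> 0" using v q0 nz X0 by auto
  \<comment> \<open>Euler derivatives of \<open>log v\<close>, \<open>log h\<close>,
    \<open>log q\<close>. The last two are \<open>2 * \<eta>^2 * X^2\<close> times the given
    logarithmic derivatives in \<open>X\<close>, and \<open>\<eta>^2 * X = X - 1\<close> then
    removes \<open>\<eta>\<close>.\<close>
  define w a b where "w = \<eta> * (deriv v \<eta> / v \<eta>)" and "a = \<eta> * (deriv h \<eta> / h \<eta>)"
    and "b = \<eta> * (deriv q \<eta> / q \<eta>)"
  have w: "\<eta> * deriv v \<eta> = w * v \<eta>" "\<eta> * deriv h \<eta> = a * h \<eta>" "\<eta> * deriv q \<eta> = b * q \<eta>"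
    using nz q0 by (auto simp: w_def a_def b_def)
  have a: "a * e = X * ((1 + g) * e - (1 - g) * (X - 1))"
  proof -
    have "a = 2 * \<eta>^2 * X^2 * (deriv h \<eta> / h \<eta> / (2 * \<eta> * X^2))"
      using nz X0 by (simp add: a_def power2_eq_square)
    also have "\<dots> * e = X * ((1 + g) * e - (1 - g) * (X - 1))"
      unfolding dh e_def[symmetric] X0(2) using nz X0 e0
      by (simp add: divide_simps power2_eq_square)
    finally show ?thesis .
  qed
  have b: "b = 2 * X - (1 + g) * V X"
  proof -
    have "b = 2 * \<eta>^2 * X^2 * (deriv q \<eta> / q \<eta> / (2 * \<eta> * X^2))"
      using nz X0 by (simp add: b_def power2_eq_square)
    also have "\<dots> = 2 * X - (1 + g) * V X"
      unfolding dq X0(2) using nz X0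
      by (simp add: divide_simps power2_eq_square)
    finally show ?thesis .
  qed
  have "2 * q \<eta> * e * (1 + a + w + 2 * \<eta>^2 * X) = 
      \<eta> * (h \<eta> * v \<eta> * X + \<eta> * deriv h \<eta> * v \<eta> * X + \<eta> * h \<eta> * deriv v \<eta> * X
       + \<eta> * h \<eta> * v \<eta> * (2 * \<eta> * X^2))"
    using w v by algebra
  also have "\<dots> = 2 * q \<eta> * (b * e + (deriv V X - 1) * (2 * \<eta>^2 * X^2))"
    unfolding main using w by algebra
  finally have "e * (1 + a + w + 2 * \<eta>^2 * X) = b * e + (deriv V X - 1) * (2 * \<eta>^2 * X^2)"
    using q0 by simp
  then have "e * (w + g) = 2 * (X * (X - 1) * deriv V X) - (1 + g) * (V X * (V X - 1))"
    using a unfolding b e_def using X0(2) by algebra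
  then have "w + g = 2 * (X * (X - 1) * deriv V X - (1 + g) / 2 * (V X * (V X - 1))) / e"
    using e0 by (simp add: eq_divide_eq mult.commute right_diff_distrib)
  then show ?thesis
    by (simp add: GC_momentum_def w_def e_def)
qed

section \<open>Conservation of the first integral\<close>

text \<open>The derivative is a combination of the left-hand sides of the three reduced equations:
  the first with multiplier \<open>2 * (w \<eta> + g)\<close>, the two linear ones with multipliers
  \<open>\<alpha>\<close> and \<open>\<beta>\<close>.\<close>

lemma has_field_derivative_first_integral:
  assumes "reduced_GC_solution g D v h q" "\<eta> \<in> D"
  shows "(first_integral g v h q has_field_derivative 0) (at \<eta>)"
proof -
  define w where "w = (\<lambda>s. s * (deriv v s / v s))"
  have D: "open D" "v holomorphic_on D" "h holomorphic_on D" "q holomorphic_on D"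
    and nz: "\<eta> \<noteq> 0" "v \<eta> \<noteq> 0" "\<And>s. s \<in> D \<Longrightarrow> v s \<noteq> 0"
    and E1: "deriv w \<eta> - (h \<eta>)^2 / (2 * \<eta>^2) * v \<eta> + 2 * (q \<eta>)^2 / (\<eta>^2 * v \<eta>) = 0"
    and E2: "- (\<eta> * v \<eta> * deriv h \<eta>) - 2 * \<eta>^2 * deriv q \<eta> + (1 + g) * v \<eta> * h \<eta> = 0"
    and E3: "- (\<eta>^2 * v \<eta> * deriv h \<eta>) - 2 * \<eta> * deriv q \<eta> + 2 * (1 - g) * q \<eta> = 0"
    using assms by (auto simp: reduced_GC_solution_def w_def)
  have "w holomorphic_on D"
    unfolding w_def using D nz by (intro holomorphic_intros holomorphic_deriv) auto
  then have w: "(w has_field_derivative deriv w \<eta>) (at \<eta>)"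
    using D assms holomorphic_derivI by blast
  note ders = D(2-4)[THEN holomorphic_derivI, OF D(1) assms(2)] w
  define v1 h1 q1 w1 where "v1 = deriv v \<eta>" and "h1 = deriv h \<eta>" and "q1 = deriv q \<eta>" and "w1 = deriv w \<eta>"
  define F where "F = 2 * (w \<eta> + g) * w1 - (2 * h \<eta> * h1 * v \<eta> / \<eta> + (h \<eta>)^2 * v1 / \<eta> - (h \<eta>)^2 * v \<eta> / \<eta>^2)
     - 2 * (h1 * q \<eta> + h \<eta> * q1) - (2 * (h1 * q \<eta> + h \<eta> * q1) / \<eta>^2 - 4 * h \<eta> * q \<eta> / \<eta>^3)
     - (8 * q \<eta> * q1 / (\<eta> * v \<eta>) - 4 * (q \<eta>)^2 / (\<eta>^2 * v \<eta>) - 4 * (q \<eta>)^2 * v1 / (\<eta> * (v \<eta>)^2))"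
  have "first_integral g v h q = (\<lambda>s. (w s + g)^2 - (h s)^2 * v s / s - 2 * h s * q s
       - 2 * h s * q s / s^2 - 4 * (q s)^2 / (s * v s))"
    by (simp add: fun_eq_iff first_integral_def w_def)
  moreover have "((\<lambda>s. (w s + g)^2 - (h s)^2 * v s / s - 2 * h s * q s
       - 2 * h s * q s / s^2 - 4 * (q s)^2 / (s * v s)) has_field_derivative F) (at \<eta>)"
  proof -
    have t1: "((\<lambda>s. (w s + g)^2) has_field_derivative 2 * (w \<eta> + g) * w1) (at \<eta>)"
      unfolding w1_def by (rule derivative_eq_intros ders refl | simp)+
    have t2: "((\<lambda>s. (h s)^2 * v s / s) has_field_derivative
        2 * h \<eta> * h1 * v \<eta> / \<eta> + (h \<eta>)^2 * v1 / \<eta> - (h \<eta>)^2 * v \<eta> / \<eta>^2) (at \<eta>)"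
      unfolding v1_def h1_def
      by (rule derivative_eq_intros ders refl | simp add: nz divide_simps; algebra)+
    have t3: "((\<lambda>s. 2 * h s * q s) has_field_derivative 2 * (h1 * q \<eta> + h \<eta> * q1)) (at \<eta>)"
      unfolding h1_def q1_def
      by (rule derivative_eq_intros ders refl | simp add: algebra_simps)+
    have t4: "((\<lambda>s. 2 * h s * q s / s^2) has_field_derivative
        2 * (h1 * q \<eta> + h \<eta> * q1) / \<eta>^2 - 4 * h \<eta> * q \<eta> / \<eta>^3) (at \<eta>)"
      unfolding h1_def q1_def
      by (rule derivative_eq_intros ders refl | simp add: nz; fail | simp add: nz divide_simps; algebra)+
    have t5: "((\<lambda>s. 4 * (q s)^2 / (s * v s)) has_field_derivative
        8 * q \<eta> * q1 / (\<eta> * v \<eta>) - 4 * (q \<eta>)^2 / (\<eta>^2 * v \<eta>) - 4 * (q \<eta>)^2 * v1 / (\<eta> * (v \<eta>)^2)) (at \<eta>)"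
      unfolding v1_def q1_def
      by (rule derivative_eq_intros ders refl | simp add: nz; fail | simp add: nz divide_simps; algebra)+
    show ?thesis
      unfolding F_def by (rule DERIV_diff t1 t2 t3 t4 t5)+
  qed
  moreover have "F = 0"
  proof -
    \<comment> \<open>Solved from two linear conditions: the combination has to reproduce all terms
      of \<open>F\<close> in \<open>h1\<close> (this is \<open>e1\<close>) and in \<open>q1\<close>
      (this is \<open>e2\<close>).\<close>
    define \<alpha> \<beta> where "\<alpha> = h \<eta> / \<eta>^2 + 2 * q \<eta> / (\<eta>^3 * v \<eta>)" and "\<beta> = h \<eta> / \<eta>^3 + 2 * q \<eta> / (\<eta>^2 * v \<eta>)"
    have W: "w1 = (h \<eta>)^2 * v \<eta> / (2 * \<eta>^2) - 2 * (q \<eta>)^2 / (\<eta>^2 * v \<eta>)"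
      using E1 by (simp add: w1_def algebra_simps)
    have v1: "v1 = w \<eta> * v \<eta> / \<eta>"
      using nz by (simp add: v1_def w_def)
    have e1: "\<alpha> * (\<eta> * v \<eta> * h1) + \<beta> * (\<eta>^2 * v \<eta> * h1)
        = 2 * h \<eta> * h1 * v \<eta> / \<eta> + 2 * (h1 * q \<eta>) + 2 * (h1 * q \<eta>) / \<eta>^2"
      unfolding \<alpha>_def \<beta>_def by (simp add: nz divide_simps) algebra
    have e2: "\<alpha> * (2 * \<eta>^2 * q1) + \<beta> * (2 * \<eta> * q1)
        = 2 * (h \<eta> * q1) + 2 * (h \<eta> * q1) / \<eta>^2 + 8 * q \<eta> * q1 / (\<eta> * v \<eta>)"
      unfolding \<alpha>_def \<beta>_def by (simp add: nz divide_simps) algebra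
    have e3: "\<alpha> * (\<eta> * v \<eta> * h1) + \<alpha> * (2 * \<eta>^2 * q1) = \<alpha> * ((1 + g) * v \<eta> * h \<eta>)"
      using E2 unfolding h1_def q1_def by algebra
    have e4: "\<beta> * (\<eta>^2 * v \<eta> * h1) + \<beta> * (2 * \<eta> * q1) = \<beta> * (2 * (1 - g) * q \<eta>)"
      using E3 unfolding h1_def q1_def by algebra
    have e5: "2 * (w \<eta> + g) * w1 - (h \<eta>)^2 * v1 / \<eta> + (h \<eta>)^2 * v \<eta> / \<eta>^2 + 4 * h \<eta> * q \<eta> / \<eta>^3
         + 4 * (q \<eta>)^2 / (\<eta>^2 * v \<eta>) + 4 * (q \<eta>)^2 * v1 / (\<eta> * (v \<eta>)^2)
       = \<alpha> * ((1 + g) * v \<eta> * h \<eta>) + \<beta> * (2 * (1 - g) * q \<eta>)"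
    proof -
      \<comment> \<open>Every remaining term is a multiple of one of these three monomials, so the
        identity becomes polynomial in \<open>g\<close>, \<open>w \<eta>\<close>, \<open>A\<close>,
        \<open>B\<close>, \<open>C\<close>.\<close>
      define A B C where "A = (h \<eta>)^2 * v \<eta> / \<eta>^2" and "B = (q \<eta>)^2 / (\<eta>^2 * v \<eta>)"
        and "C = h \<eta> * q \<eta> / \<eta>^3"
      have eqs: "(h \<eta>)^2 * v1 / \<eta> = w \<eta> * A" "4 * (q \<eta>)^2 * v1 / (\<eta> * (v \<eta>)^2) = 4 * w \<eta> * B"
        "\<alpha> * ((1 + g) * v \<eta> * h \<eta>) = (1 + g) * (A + 2 * C)"
        "\<beta> * (2 * (1 - g) * q \<eta>) = 2 * (1 - g) * (C + 2 * B)"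
        "w1 = A / 2 - 2 * B" "(h \<eta>)^2 * v \<eta> / \<eta>^2 = A"
        "4 * h \<eta> * q \<eta> / \<eta>^3 = 4 * C" "4 * (q \<eta>)^2 / (\<eta>^2 * v \<eta>) = 4 * B"
        using nz unfolding A_def B_def C_def v1 \<alpha>_def \<beta>_def W
        by (simp_all add: field_simps power2_eq_square power3_eq_cube)
      show ?thesis unfolding eqs by algebra
    qed
    have "F = (2 * (w \<eta> + g) * w1 - (h \<eta>)^2 * v1 / \<eta> + (h \<eta>)^2 * v \<eta> / \<eta>^2 + 4 * h \<eta> * q \<eta> / \<eta>^3
         + 4 * (q \<eta>)^2 / (\<eta>^2 * v \<eta>) + 4 * (q \<eta>)^2 * v1 / (\<eta> * (v \<eta>)^2))
       - (2 * h \<eta> * h1 * v \<eta> / \<eta> + 2 * (h1 * q \<eta>) + 2 * (h1 * q \<eta>) / \<eta>^2)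
       - (2 * (h \<eta> * q1) + 2 * (h \<eta> * q1) / \<eta>^2 + 8 * q \<eta> * q1 / (\<eta> * v \<eta>))"
      unfolding F_def by (simp add: distrib_left add_divide_distrib)
    also have "\<dots> = 0"
      unfolding e5 e1[symmetric] e2[symmetric] e3[symmetric] e4[symmetric] by simp
    finally show ?thesis .
  qed
  ultimately show ?thesis by simp
qed

lemma deriv_Xmap: "\<eta>^2 \<noteq> 1 \<Longrightarrow> deriv Xmap \<eta> = 2 * \<eta> * (Xmap \<eta>)^2"
  by (rule DERIV_imp_deriv[OF has_field_derivative_Xmap])

lemma Xmap_domain:
  assumes "D \<inter> {0, 1, -1} = {}" "\<eta> \<in> D"
  shows "\<eta> \<noteq> 0" "\<eta>^2 \<noteq> (1::complex)"
  using assms by (auto simp: power2_eq_1_iff)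

lemma hq_of_V_eq_momentum:
  assumes "V X \<noteq> X"
  shows "hq_of_V g K V X = 2 * (X - 1) / (V X * (V X - 1) * (V X - X))
           * ((GC_momentum g V X * (V X - X) / 2)^2 - K / 4 * (V X - X)^2)"
proof -
  have "2 * a / (V X - X) * (V X - X) / 2 = a" for a
    using assms by simp
  then show ?thesis by (simp only: hq_of_V_def GC_momentum_def)
qed

lemma given_byD:
  assumes "given_by g K V D v h q" "\<eta> \<in> D" "D \<inter> {0, 1, -1} = {}" and X: "X = Xmap \<eta>"
  shows "v \<eta> \<noteq> 0" "h \<eta> \<noteq> 0" "q \<eta> \<noteq> 0"
    "\<eta> * h \<eta> * v \<eta> / (2 * q \<eta>) = (V X - X) / X"
    "deriv h \<eta> / h \<eta> / (2 * \<eta> * X^2) = (1 + g) / (2 * (X - 1)) - (1 - g) / (2 * (V X - X))"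
    "deriv q \<eta> / q \<eta> / (2 * \<eta> * X^2) = 1 / (X - 1) - (1 + g) * V X / (2 * X * (X - 1))"
    "h \<eta> * q \<eta> = hq_of_V g K V X"
  using assms deriv_Xmap[OF Xmap_domain(2)[OF assms(3,2)]]
  by (auto simp: given_by_def Let_def dlog_dX_def)

lemma first_integral_constant:
  assumes "connected D" "reduced_GC_solution g D v h q"
  shows "\<exists>K. \<forall>\<eta>\<in>D. first_integral g v h q \<eta> = K"
proof -
  have "open D" using assms by (simp add: reduced_GC_solution_def)
  note d = has_field_derivative_first_integral[OF assms(2)]
  have "continuous_on D (first_integral g v h q)"
    using d by (intro continuous_at_imp_continuous_on ballI DERIV_isCont)
  then have "first_integral g v h q constant_on D"
    using DERIV_zero_connected_constant_on[OF assms(1) \<open>open D\<close>, of "{}"] d by simp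
  then show ?thesis by (simp add: constant_on_def)
qed

section \<open>From a sixth Painleve function to a solution of the reduced system\<close>

lemma PVI_momentum_equation:
  assumes "PVI_function (((1 + g) / 2)^2) (K / 4) (K / 4) (((1 - g) / 2)^2) S V" "X \<in> S"
  shows "(GC_momentum g V has_field_derivative
               ((GC_momentum g V X)^2 - K) * ((V X)^2 - 2 * X * V X + X)
                 / (4 * (X * (X - 1)) * (V X * (V X - 1)))) (at X)"
proof (subst PVI_iff_momentum_equation [symmetric])
  show "open S" "V holomorphic_on S" "X \<in> S" "V X \<noteq> 0" "V X \<noteq> 1" "V X \<noteq> X"
    using assms by (auto simp: PVI_function_def)
  show "X \<noteq> 0" "X \<noteq> 1"
    using assms by (auto simp: PVI_function_def)
qed (use assms in \<open>auto simp: PVI_function_def\<close>)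

text \<open>The formula for \<open>h * q\<close> says that the first integral, written with
  \<open>P\<close> in place of \<open>\<eta> * v'/v + g\<close>, equals \<open>K\<close>, and
  \<open>dlog_v_eq_momentum\<close> identifies the two. The momentum equation pulled back along
  \<open>Xmap\<close> becomes the first reduced equation; the logarithmic derivatives give the
  linear ones.\<close>

lemma reduced_GC_solution_of_PVI:
  assumes pv: "PVI_function (((1 + g) / 2)^2) (K / 4) (K / 4) (((1 - g) / 2)^2) S V"
    and D: "open D" "D \<inter> {0, 1, -1} = {}" "Xmap ` D \<subseteq> S"
    and gb: "given_by g K V D v h q"
  shows "reduced_GC_solution g D v h q" and "\<forall>\<eta>\<in>D. first_integral g v h q \<eta> = K"
proof -
  have hol: "v holomorphic_on D" "h holomorphic_on D" "q holomorphic_on D"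
    using gb by (auto simp: given_by_def)
  have S: "open S" "V holomorphic_on S"
    "\<And>X. X \<in> S \<Longrightarrow> V X \<noteq> 0 \<and> V X \<noteq> 1 \<and> V X \<noteq> X"
    using pv by (auto simp: PVI_function_def)
  have XS: "Xmap \<eta> \<in> S" if "\<eta> \<in> D" for \<eta> using D that by auto
  note dom = Xmap_domain[OF D(2)]
  note gbD = given_byD[OF gb _ D(2) refl]
  have P: "\<eta> * (deriv v \<eta> / v \<eta>) + g = GC_momentum g V (Xmap \<eta>)" if \<eta>: "\<eta> \<in> D" for \<eta>
  proof (rule dlog_v_eq_momentum[OF D(1) \<eta> hol])
    show "(V has_field_derivative deriv V (Xmap \<eta>)) (at (Xmap \<eta>))"
      using S XS[OF \<eta>] holomorphic_derivI by blast
    show "Xmap s \<noteq> 0" if "s \<in> D" for s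
      using dom[OF that] Xmap_nz by blast
  qed (use gbD dom \<eta> in auto)
  have main: "first_integral g v h q \<eta> = K \<and>
      deriv (\<lambda>s. s * (deriv v s / v s)) \<eta>
          - (h \<eta>)^2 / (2 * \<eta>^2) * v \<eta> + 2 * (q \<eta>)^2 / (\<eta>^2 * v \<eta>) = 0 \<and>
        - (\<eta> * v \<eta> * deriv h \<eta>) - 2 * \<eta>^2 * deriv q \<eta> + (1 + g) * v \<eta> * h \<eta> = 0 \<and>
        - (\<eta>^2 * v \<eta> * deriv h \<eta>) - 2 * \<eta> * deriv q \<eta> + 2 * (1 - g) * q \<eta> = 0"
    if \<eta>: "\<eta> \<in> D" for \<eta>
  proof -
    define X where "X = Xmap \<eta>"
    have V: "V X \<noteq> 0" "V X \<noteq> 1" "V X \<noteq> X" using S(3) XS[OF \<eta>] by (auto simp: X_def)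
    note fi = first_integral_iff_hq[OF dom[OF \<eta>] gbD(1-3)[OF \<eta>] V(1,2) X_def gbD(4)[OF \<eta>, folded X_def],
        where P = "GC_momentum g V X" and K = K]
    have K: "(GC_momentum g V X)^2 - (h \<eta>)^2 * v \<eta> / \<eta> - 2 * h \<eta> * q \<eta>
       - 2 * h \<eta> * q \<eta> / \<eta>^2 - 4 * (q \<eta>)^2 / (\<eta> * v \<eta>) = K"
      using fi(1) gbD(7)[OF \<eta>, folded X_def] hq_of_V_eq_momentum[of V X] V(3) by simp
    have "((\<lambda>s. GC_momentum g V (Xmap s) - g) has_field_derivative
        ((GC_momentum g V X)^2 - K) * ((V X)^2 - 2 * X * V X + X)
           / (4 * (X * (X - 1)) * (V X * (V X - 1))) * (2 * \<eta> * X^2) - 0) (at \<eta>)"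
      unfolding X_def
      by (intro DERIV_diff DERIV_const DERIV_chain2[OF PVI_momentum_equation[OF pv XS[OF \<eta>]]
            has_field_derivative_Xmap] dom \<eta>)
    then have "((\<lambda>s. s * (deriv v s / v s)) has_field_derivative
        ((GC_momentum g V X)^2 - K) * ((V X)^2 - 2 * X * V X + X)
           / (4 * (X * (X - 1)) * (V X * (V X - 1))) * (2 * \<eta> * X^2) - 0) (at \<eta>)"
      by (rule has_field_derivative_transform_within_open[OF _ D(1) \<eta>]) (simp flip: P)
    then have "deriv (\<lambda>s. s * (deriv v s / v s)) \<eta> =
        (h \<eta>)^2 / (2 * \<eta>^2) * v \<eta> - 2 * (q \<eta>)^2 / (\<eta>^2 * v \<eta>)"
      using fi(2)[OF K] by (simp add: DERIV_imp_deriv)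
    moreover have "first_integral g v h q \<eta> = K"
      unfolding first_integral_def using P[OF \<eta>] K by (simp add: X_def)
    ultimately show ?thesis
      using linear_equations_iff_dlog[OF dom[OF \<eta>] gbD(1-3)[OF \<eta>] refl gbD(4)[OF \<eta>]]
        gbD(5,6)[OF \<eta>] by simp
  qed
  then show "\<forall>\<eta>\<in>D. first_integral g v h q \<eta> = K" by blast
  show "reduced_GC_solution g D v h q"
    unfolding reduced_GC_solution_def using D hol main gbD(1) by auto
qed

section \<open>From a solution of the reduced system to a sixth Painleve function\<close>

lemma sparse_in_zeros:
  assumes "f holomorphic_on D" "open D" "connected D" "\<exists>z\<in>D. f z \<noteq> 0"
  shows "{z \<in> D. f z = 0} sparse_in D"
  unfolding sparse_in_eventually_iff[OF assms(2)]
proof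
  fix z assume "z \<in> D"
  obtain b where "b \<in> D" "f b \<noteq> 0" using assms by blast
  from non_zero_neighbour_alt[OF assms(1-3) \<open>z \<in> D\<close> this]
  show "\<forall>\<^sub>F y in at z. y \<notin> {z \<in> D. f z = 0}"
    by (rule eventually_mono) simp
qed

text \<open>These two degenerate branches are \<open>V = 0\<close> and \<open>V = 1\<close>. On either of them
  \<open>\<eta> v'/v = -g\<close>, so the first equation forces \<open>h\<^sup>2 v\<^sup>2 = 4 q\<^sup>2\<close>.\<close>

lemma reduced_GC_solution_nondegenerate:
  assumes red: "reduced_GC_solution g D v h q" and D0: "D \<inter> {0, 1, -1} = {}"
    and h0: "\<exists>\<eta>\<in>D. h \<eta> \<noteq> 0"
  shows "\<exists>\<eta>\<in>D. \<eta> * h \<eta> * v \<eta> + 2 * q \<eta> \<noteq> 0" and "\<exists>\<eta>\<in>D. h \<eta> * v \<eta> + 2 * \<eta> * q \<eta> \<noteq> 0"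
proof -
  have D: "open D" "v holomorphic_on D" "h holomorphic_on D" "q holomorphic_on D"
    and v0: "\<And>s. s \<in> D \<Longrightarrow> v s \<noteq> 0"
    and E1: "\<And>\<eta>. \<eta> \<in> D \<Longrightarrow> deriv (\<lambda>s. s * (deriv v s / v s)) \<eta>
         - (h \<eta>)^2 / (2 * \<eta>^2) * v \<eta> + 2 * (q \<eta>)^2 / (\<eta>^2 * v \<eta>) = 0"
    and E2: "\<And>\<eta>. \<eta> \<in> D \<Longrightarrow> - (\<eta> * v \<eta> * deriv h \<eta>) - 2 * \<eta>^2 * deriv q \<eta> + (1 + g) * v \<eta> * h \<eta> = 0"
    and E3: "\<And>\<eta>. \<eta> \<in> D \<Longrightarrow> - (\<eta>^2 * v \<eta> * deriv h \<eta>) - 2 * \<eta> * deriv q \<eta> + 2 * (1 - g) * q \<eta> = 0"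
    using red by (auto simp: reduced_GC_solution_def)
  note dom = Xmap_domain[OF D0]
  note ders = D(2-4)[THEN holomorphic_derivI, OF D(1)]
  obtain \<eta>0 where \<eta>0: "\<eta>0 \<in> D" "h \<eta>0 \<noteq> 0" using h0 by blast
  \<comment> \<open>On \<open>D1\<close> the factor \<open>h\<close> may be cancelled; as
    \<open>D1\<close> is open, an identity on it can still be differentiated at
    \<open>\<eta>0\<close>.\<close>
  define D1 where "D1 = {s \<in> D. h s \<noteq> 0}"
  have "open (D \<inter> h -` (- {0}))"
    using D holomorphic_on_imp_continuous_on by (intro continuous_open_preimage) auto
  also have "D \<inter> h -` (- {0}) = D1" by (auto simp: D1_def)
  finally have D1: "open D1" "\<eta>0 \<in> D1" using \<eta>0 by (auto simp: D1_def)
  have *: "(h \<eta>0 * v \<eta>0)^2 = 4 * (q \<eta>0)^2" if w: "\<And>s. s \<in> D1 \<Longrightarrow> s * deriv v s = - g * v s"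
  proof -
    have "((\<lambda>s. s * (deriv v s / v s)) has_field_derivative 0) (at \<eta>0)"
    proof (rule has_field_derivative_transform_within_open[OF DERIV_const D1])
      show "- g = s * (deriv v s / v s)" if "s \<in> D1" for s
        using w[OF that] v0 that by (simp add: D1_def)
    qed
    from DERIV_imp_deriv[OF this] E1[OF \<eta>0(1)]
    show ?thesis
      using v0[OF \<eta>0(1)] dom[OF \<eta>0(1)] by (simp add: divide_simps power2_eq_square mult_ac split: if_splits)
  qed
  show "\<exists>\<eta>\<in>D. \<eta> * h \<eta> * v \<eta> + 2 * q \<eta> \<noteq> 0"
  proof (rule ccontr)
    assume "\<not> ?thesis"
    then have eq: "2 * q s = - (s * h s * v s)" if "s \<in> D" for s
      using that by (simp add: eq_neg_iff_add_eq_0 add.commute)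
    have "s * deriv v s = - g * v s" if "s \<in> D1" for s
    proof -
      have s: "s \<in> D" "h s \<noteq> 0" using that by (auto simp: D1_def)
      have "((\<lambda>s. - (s * h s * v s)) has_field_derivative
          - (h s * v s + s * deriv h s * v s + s * h s * deriv v s)) (at s)"
        by (rule derivative_eq_intros ders s refl | simp add: algebra_simps)+
      moreover have "((\<lambda>s. - (s * h s * v s)) has_field_derivative 2 * deriv q s) (at s)"
        by (rule has_field_derivative_transform_within_open[OF DERIV_cmult[OF ders(3)[OF s(1)]] D(1) s(1) eq])
      ultimately have d: "2 * deriv q s = - (h s * v s + s * deriv h s * v s + s * h s * deriv v s)"
        using DERIV_unique by blast
      \<comment> \<open>Result of eliminating \<open>h'\<close>, \<open>q'\<close> and
        \<open>q\<close> between \<open>d\<close>, \<open>eq\<close> and the two linear equations;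
        the factors in front are nonzero on \<open>D1\<close>.\<close>
      have "s * (1 - s^2) * h s * (s * deriv v s + g * v s) = 0"
        using d eq[OF s(1)] E2[OF s(1)] E3[OF s(1)] by algebra
      then show ?thesis using s dom[OF s(1)] by (simp add: eq_neg_iff_add_eq_0)
    qed
    \<comment> \<open>Squaring \<open>eq\<close> gives
      \<open>4 * q^2 = \<eta>0^2 * (h * v)^2\<close> at \<open>\<eta>0\<close>, against
      \<open>4 * q^2 = (h * v)^2\<close>.\<close>
    from *[OF this] have "(1 - \<eta>0^2) * (h \<eta>0 * v \<eta>0)^2 = 0"
      using eq[OF \<eta>0(1)] by algebra
    then show False using \<eta>0 v0 dom by simp
  qed
  show "\<exists>\<eta>\<in>D. h \<eta> * v \<eta> + 2 * \<eta> * q \<eta> \<noteq> 0"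
  proof (rule ccontr)
    assume "\<not> ?thesis"
    then have eq: "2 * s * q s = - (h s * v s)" if "s \<in> D" for s
      using that by (simp add: eq_neg_iff_add_eq_0 add.commute)
    have "s * deriv v s = - g * v s" if "s \<in> D1" for s
    proof -
      have s: "s \<in> D" "h s \<noteq> 0" using that by (auto simp: D1_def)
      have "((\<lambda>s. - (h s * v s)) has_field_derivative
          - (deriv h s * v s + h s * deriv v s)) (at s)"
        by (rule derivative_eq_intros ders s refl | simp add: algebra_simps)+
      moreover have "((\<lambda>s. 2 * s * q s) has_field_derivative 2 * q s + 2 * s * deriv q s) (at s)"
        by (rule derivative_eq_intros ders s refl | simp add: algebra_simps)+
      then have "((\<lambda>s. - (h s * v s)) has_field_derivative 2 * q s + 2 * s * deriv q s) (at s)"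
        by (rule has_field_derivative_transform_within_open[OF _ D(1) s(1) eq])
      ultimately have d: "2 * q s + 2 * s * deriv q s = - (deriv h s * v s + h s * deriv v s)"
        using DERIV_unique by blast
      have "(1 - s^2) * h s * (s * deriv v s + g * v s) = 0"
        using d eq[OF s(1)] E2[OF s(1)] E3[OF s(1)] by algebra
      then show ?thesis using s dom[OF s(1)] by (simp add: eq_neg_iff_add_eq_0)
    qed
    from *[OF this] have "(1 - \<eta>0^2) * (h \<eta>0 * v \<eta>0)^2 = 0"
      using eq[OF \<eta>0(1)] by algebra
    then show False using \<eta>0 v0 dom by simp
  qed
qed

text \<open>Here \<open>g^2 \<noteq> 1\<close> enters. If \<open>q\<close> vanished identically, the
  third equation would give \<open>h' = 0\<close> and then the second
  \<open>(1 + g) * v * h = 0\<close>; if \<open>h\<close> did, the second would give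
  \<open>q' = 0\<close> and the third \<open>(1 - g) * q = 0\<close>.\<close>

lemma reduced_GC_solution_nonzero:
  assumes g: "g^2 \<noteq> 1" and red: "reduced_GC_solution g D v h q"
    and ne: "\<exists>\<eta>\<in>D. h \<eta> \<noteq> 0 \<or> q \<eta> \<noteq> 0"
  shows "\<exists>\<eta>\<in>D. h \<eta> \<noteq> 0" and "\<exists>\<eta>\<in>D. q \<eta> \<noteq> 0"
proof -
  have D: "open D" "v holomorphic_on D" "h holomorphic_on D" "q holomorphic_on D" "0 \<notin> D"
    and v0: "\<And>s. s \<in> D \<Longrightarrow> v s \<noteq> 0"
    and E2: "\<And>\<eta>. \<eta> \<in> D \<Longrightarrow> - (\<eta> * v \<eta> * deriv h \<eta>) - 2 * \<eta>^2 * deriv q \<eta> + (1 + g) * v \<eta> * h \<eta> = 0"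
    and E3: "\<And>\<eta>. \<eta> \<in> D \<Longrightarrow> - (\<eta>^2 * v \<eta> * deriv h \<eta>) - 2 * \<eta> * deriv q \<eta> + 2 * (1 - g) * q \<eta> = 0"
    using red by (auto simp: reduced_GC_solution_def)
  have g': "1 - g \<noteq> 0" "1 + g \<noteq> 0"
    using g by (auto simp: power2_eq_1_iff add_eq_0_iff)
  have zero: "deriv f s = 0" if "\<And>x. x \<in> D \<Longrightarrow> f x = 0" "s \<in> D" for f s
    using that by (intro DERIV_imp_deriv has_field_derivative_transform_within_open[OF DERIV_const D(1)]) auto
  have "\<exists>\<eta>\<in>D. q \<eta> \<noteq> 0" if "\<exists>\<eta>\<in>D. h \<eta> \<noteq> 0"
  proof (rule ccontr)
    assume "\<not> ?thesis"
    then have q: "q s = 0" if "s \<in> D" for s using that by auto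
    have "h s = 0" if s: "s \<in> D" for s
    proof -
      have "s \<noteq> 0" using s D by auto
      then show ?thesis
        using E2[OF s] E3[OF s] v0[OF s] g' by (simp add: q[OF s] zero[of q, OF q s])
    qed
    then show False using that by auto
  qed
  moreover show "\<exists>\<eta>\<in>D. h \<eta> \<noteq> 0"
  proof (rule ccontr)
    assume "\<not> ?thesis"
    then have h: "h s = 0" if "s \<in> D" for s using that by auto
    have "q s = 0" if s: "s \<in> D" for s
    proof -
      have "s \<noteq> 0" using s D by auto
      then show ?thesis
        using E2[OF s] E3[OF s] v0[OF s] g' by (simp add: h[OF s] zero[of h, OF h s])
    qed
    then show False using ne h by auto
  qed
  ultimately show "\<exists>\<eta>\<in>D. q \<eta> \<noteq> 0" .
qed

text \<open>\<open>V\<close> is read off from \<open>\<eta> * h * v / (2 * q) = (V - X) / X\<close>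
  as a function of \<open>X\<close>, through the inverse of \<open>Xmap\<close> that injectivity
  supplies. With \<open>P = \<eta> * v'/v + g\<close> the first reduced equation becomes the
  momentum equation, hence the Painleve equation.\<close>

lemma PVI_of_reduced_GC_solution:
  assumes g: "g^2 \<noteq> 1" and conn: "connected D" and D0: "D \<inter> {0, 1, -1} = {}"
    and inj: "inj_on Xmap D" and red: "reduced_GC_solution g D v h q"
    and K: "\<forall>\<eta>\<in>D. first_integral g v h q \<eta> = K"
    and ne: "\<exists>\<eta>\<in>D. h \<eta> \<noteq> 0 \<or> q \<eta> \<noteq> 0"
  shows "\<exists>V Z. Z \<subseteq> D \<and> Z sparse_in D \<and>
           PVI_function (((1 + g) / 2)^2) (K / 4) (K / 4) (((1 - g) / 2)^2) (Xmap ` (D - Z)) V \<and>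
           given_by g K V (D - Z) v h q"
proof -
  define w where "w = (\<lambda>s. s * (deriv v s / v s))"
  have D: "open D" "v holomorphic_on D" "h holomorphic_on D" "q holomorphic_on D"
    and v0: "\<And>s. s \<in> D \<Longrightarrow> v s \<noteq> 0"
    and E1: "\<And>\<eta>. \<eta> \<in> D \<Longrightarrow> deriv w \<eta> - (h \<eta>)^2 / (2 * \<eta>^2) * v \<eta> + 2 * (q \<eta>)^2 / (\<eta>^2 * v \<eta>) = 0"
    and E23: "\<And>\<eta>. \<eta> \<in> D \<Longrightarrow>
          - (\<eta> * v \<eta> * deriv h \<eta>) - 2 * \<eta>^2 * deriv q \<eta> + (1 + g) * v \<eta> * h \<eta> = 0 \<and>
          - (\<eta>^2 * v \<eta> * deriv h \<eta>) - 2 * \<eta> * deriv q \<eta> + 2 * (1 - g) * q \<eta> = 0"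
    using red by (auto simp: reduced_GC_solution_def w_def)
  note dom = Xmap_domain[OF D0]
  note nonz = reduced_GC_solution_nonzero[OF g red ne]
  note nondeg = reduced_GC_solution_nondegenerate[OF red D0 nonz(1)]
  \<comment> \<open>The zeros of \<open>h\<close>, of \<open>q\<close>, and of the numerators of
    \<open>V\<close> and \<open>V - 1\<close>. Off \<open>Z\<close>, \<open>V\<close> is defined and
    avoids \<open>0\<close> and \<open>1\<close>; it avoids \<open>X\<close> since \<open>h\<close>
    and \<open>v\<close> have no zeros there.\<close>
  define Z where "Z = ({\<eta>\<in>D. h \<eta> = 0} \<union> {\<eta>\<in>D. q \<eta> = 0})
      \<union> ({\<eta>\<in>D. \<eta> * h \<eta> * v \<eta> + 2 * q \<eta> = 0} \<union> {\<eta>\<in>D. h \<eta> * v \<eta> + 2 * \<eta> * q \<eta> = 0})"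
  have Z: "Z \<subseteq> D" "Z sparse_in D"
    unfolding Z_def using D
    by (auto intro!: sparse_in_union' sparse_in_zeros conn nonz nondeg holomorphic_intros)
  define D' where "D' = D - Z"
  have D': "open D'" "D' \<subseteq> D" "D' \<inter> {0, 1, -1} = {}"
    using open_diff_sparse_pts[OF D(1) Z(2)] D0 by (auto simp: D'_def)
  have nz: "v s \<noteq> 0" "h s \<noteq> 0" "q s \<noteq> 0" "s * h s * v s + 2 * q s \<noteq> 0" "h s * v s + 2 * s * q s \<noteq> 0"
    if "s \<in> D'" for s using that v0 by (auto simp: D'_def Z_def)
  have hol': "v holomorphic_on D'" "h holomorphic_on D'" "q holomorphic_on D'"
    using D D'(2) holomorphic_on_subset by blast+
  have Xhol: "Xmap holomorphic_on D'"
    using D' dom has_field_derivative_Xmap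
    by (meson D'(1) D'(2) has_field_derivative_at_within holomorphic_on_open subsetD)
  have inj': "inj_on Xmap D'" using inj D'(2) inj_on_subset by blast
  \<comment> \<open>As \<open>\<eta>^2 = 1 - 1 / X\<close>, this \<open>k\<close> is a holomorphic
    branch of the square root of \<open>1 - 1 / X\<close> on the image.\<close>
  obtain k where k: "k holomorphic_on Xmap ` D'"
     "\<And>z. z \<in> D' \<Longrightarrow> deriv Xmap z * deriv k (Xmap z) = 1" "\<And>z. z \<in> D' \<Longrightarrow> k (Xmap z) = z"
    using holomorphic_has_inverse[OF Xhol D'(1) inj'] by blast
  define S where "S = Xmap ` D'"
  have S: "open S" unfolding S_def by (rule open_mapping_thm3[OF Xhol D'(1) inj'])
  have kS: "k ` S \<subseteq> D'" "k holomorphic_on S" using k by (auto simp: S_def)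
  have comp: "(\<lambda>X. f (k X)) holomorphic_on S" if "f holomorphic_on D'" for f
    using holomorphic_on_compose_gen[OF kS(2) that kS(1)] by (simp add: o_def)
  define V where "V = (\<lambda>X. X + X * (k X * h (k X) * v (k X) / (2 * q (k X))))"
  have Vhol: "V holomorphic_on S"
    unfolding V_def using kS nz(3) by (intro holomorphic_intros comp hol') auto
  have VX: "V X = X + X * (\<eta> * h \<eta> * v \<eta> / (2 * q \<eta>))" if "\<eta> \<in> D'" "X = Xmap \<eta>" for X \<eta>
    using that k(3) by (simp add: V_def)
  have main: "V X \<noteq> 0 \<and> V X \<noteq> 1 \<and> V X \<noteq> X \<and> X \<noteq> 0 \<and> X \<noteq> 1 \<and>
     \<eta> * h \<eta> * v \<eta> / (2 * q \<eta>) = (V X - X) / X \<and>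
     deriv h \<eta> / h \<eta> / (2 * \<eta> * X^2) = (1 + g) / (2 * (X - 1)) - (1 - g) / (2 * (V X - X)) \<and>
     deriv q \<eta> / q \<eta> / (2 * \<eta> * X^2) = 1 / (X - 1) - (1 + g) * V X / (2 * X * (X - 1))"
    if \<eta>: "\<eta> \<in> D'" and X: "X = Xmap \<eta>" for \<eta> X
  proof -
    have \<eta>D: "\<eta> \<in> D" using \<eta> D' by auto
    note X0 = Xmap_nz[OF dom[OF \<eta>D], folded X]
    note nz = nz[OF \<eta>]
    have U: "\<eta> * h \<eta> * v \<eta> / (2 * q \<eta>) = (V X - X) / X"
      using VX[OF \<eta> X] X0(1) by simp
    have "V X = X * ((\<eta> * h \<eta> * v \<eta> + 2 * q \<eta>) / (2 * q \<eta>))"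
      unfolding VX[OF \<eta> X] using nz(3) by (simp add: field_simps)
    moreover have "V X - 1 = (X - 1) + X * (\<eta> * h \<eta> * v \<eta> / (2 * q \<eta>))"
      unfolding VX[OF \<eta> X] by simp
    then have "V X - 1 = \<eta> * X * ((h \<eta> * v \<eta> + 2 * \<eta> * q \<eta>) / (2 * q \<eta>))"
      unfolding X0(3) using nz(3) by (simp add: field_simps power2_eq_square)
    ultimately have "V X \<noteq> 0" "V X - 1 \<noteq> 0" "V X \<noteq> X"
      using nz X0(1) dom[OF \<eta>D] VX[OF \<eta> X] by auto
    then show ?thesis
      using linear_equations_iff_dlog[OF dom[OF \<eta>D] nz(1-3) X U] E23[OF \<eta>D] U X0 by auto
  qed
  have P: "w \<eta> + g = GC_momentum g V (Xmap \<eta>)" if \<eta>: "\<eta> \<in> D'" for \<eta>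
    unfolding w_def
  proof (rule dlog_v_eq_momentum[OF D'(1) \<eta> hol'])
    show "(V has_field_derivative deriv V (Xmap \<eta>)) (at (Xmap \<eta>))"
      using Vhol S \<eta> holomorphic_derivI by (auto simp: S_def)
  qed (use main nz dom D' \<eta> in auto)
  have whol: "w holomorphic_on D"
    unfolding w_def using D v0 by (intro holomorphic_intros holomorphic_deriv) auto
  have main2: "h \<eta> * q \<eta> = hq_of_V g K V X \<and>
     deriv (deriv V) X = PVI_rhs (((1 + g) / 2)^2) (K / 4) (K / 4) (((1 - g) / 2)^2) X (V X) (deriv V X)"
    if \<eta>: "\<eta> \<in> D'" and X: "X = Xmap \<eta>" for \<eta> X
  proof -
    have \<eta>D: "\<eta> \<in> D" using \<eta> D' by auto
    have XS: "X \<in> S" using \<eta> X by (simp add: S_def)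
    note m = main[OF \<eta> X]
    note fi = first_integral_iff_hq[OF dom[OF \<eta>D] nz(1-3)[OF \<eta>] _ _ X,
        where V = "V X" and P = "GC_momentum g V X" and K = K]
    have K': "(GC_momentum g V X)^2 - (h \<eta>)^2 * v \<eta> / \<eta> - 2 * h \<eta> * q \<eta>
       - 2 * h \<eta> * q \<eta> / \<eta>^2 - 4 * (q \<eta>)^2 / (\<eta> * v \<eta>) = K"
      using K \<eta>D P[OF \<eta>] X by (auto simp: first_integral_def w_def)
    define R where "R = ((GC_momentum g V X)^2 - K) * ((V X)^2 - 2 * X * V X + X)
           / (4 * (X * (X - 1)) * (V X * (V X - 1)))"
    have w1: "deriv w \<eta> = (h \<eta>)^2 / (2 * \<eta>^2) * v \<eta> - 2 * (q \<eta>)^2 / (\<eta>^2 * v \<eta>)"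
      using E1[OF \<eta>D] by algebra
    \<comment> \<open>Composing with \<open>k\<close> turns \<open>P = w + g\<close> into an
      identity in \<open>X\<close> that can be differentiated there; \<open>deriv k X\<close> is the
      reciprocal of the factor \<open>2 * \<eta> * X^2\<close> in \<open>fi(2)\<close>.\<close>
    have "(w has_field_derivative deriv w \<eta>) (at (k X))"
      using holomorphic_derivI[OF whol D(1) \<eta>D] k(3)[OF \<eta>] X by simp
    from DERIV_chain2[OF this holomorphic_derivI[OF kS(2) S XS]]
    have "((\<lambda>Y. w (k Y) + g) has_field_derivative deriv w \<eta> * deriv k X + 0) (at X)"
      by (intro DERIV_add DERIV_const)
    then have dP: "(GC_momentum g V has_field_derivative deriv w \<eta> * deriv k X + 0) (at X)"
      by (rule has_field_derivative_transform_within_open[OF _ S XS])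
         (use P k(3) in \<open>auto simp: S_def\<close>)
    have "deriv w \<eta> = R * (2 * \<eta> * X^2)"
      unfolding w1 R_def using fi(2)[OF _ _ _ K'] m by simp
    moreover have "(2 * \<eta> * X^2) * deriv k X = 1"
      using k(2)[OF \<eta>] deriv_Xmap[OF dom(2)[OF \<eta>D]] X by simp
    ultimately have "deriv w \<eta> * deriv k X + 0 = R" by (simp add: mult.assoc)
    with dP have "(GC_momentum g V has_field_derivative R) (at X)" by simp
    moreover have "h \<eta> * q \<eta> = hq_of_V g K V X"
      using fi(1)[OF _ _ _] K' m hq_of_V_eq_momentum[of V X] by simp
    ultimately show ?thesis
      using PVI_iff_momentum_equation[OF S Vhol XS] m by (simp add: R_def)
  qed
  have "PVI_function (((1 + g) / 2)^2) (K / 4) (K / 4) (((1 - g) / 2)^2) S V"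
    unfolding PVI_function_def using S Vhol main main2 by (auto simp: S_def)
  moreover have "given_by g K V D' v h q"
    unfolding given_by_def Let_def dlog_dX_def
    using hol' main main2 nz deriv_Xmap dom D'(2) by (auto simp: subset_iff)
  ultimately show ?thesis
    using Z unfolding S_def D'_def by blast
qed

section \<open>Existence of \<open>v\<close>, \<open>h\<close>, \<open>q\<close> for a prescribed
  Painleve function\<close>

text \<open>Compatibility of the formula for \<open>h * q\<close> with the two prescribed
  logarithmic derivatives, whose sum appears on the right. The value of \<open>hq_of_V\<close> is
  kept as a factor instead of being divided out, so its zeros are covered too.\<close>

lemma has_field_derivative_hq_of_V:
  assumes pv: "PVI_function (((1 + g) / 2)^2) (K / 4) (K / 4) (((1 - g) / 2)^2) S V" and X: "X \<in> S"
  shows "(hq_of_V g K V has_field_derivative hq_of_V g K V X *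
           (((1 + g) / (2 * (X - 1)) - (1 - g) / (2 * (V X - X)))
            + (1 / (X - 1) - (1 + g) * V X / (2 * X * (X - 1))))) (at X)"
proof -
  define P where "P = GC_momentum g V"
  define s m n e y V1 where "s = (1 + g) / 2" and "m = X * (X - 1)" and "n = V X * (V X - 1)"
    and "e = V X - X" and "y = (V X)^2 - 2 * X * V X + X" and "V1 = deriv V X"
  have S: "open S" "V holomorphic_on S"
    "\<And>X. X \<in> S \<Longrightarrow> V X \<noteq> 0 \<and> V X \<noteq> 1 \<and> V X \<noteq> X \<and> X \<noteq> 0 \<and> X \<noteq> 1"
    using pv by (auto simp: PVI_function_def)
  have nz: "m \<noteq> 0" "n \<noteq> 0" "e \<noteq> 0" "X \<noteq> 0" "X - 1 \<noteq> 0"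
    using S(3)[OF X] by (auto simp: m_def n_def e_def)
  have dV: "(V has_field_derivative V1) (at X)"
    using S X holomorphic_derivI by (auto simp: V1_def)
  have dP: "(P has_field_derivative ((P X)^2 - K) * y / (4 * m * n)) (at X)"
    using PVI_momentum_equation[OF pv X] by (simp add: P_def y_def m_def n_def mult.assoc)
  define W where "W = (P X)^2 - K"
  have hq: "hq_of_V g K V Y = (Y - 1) * (V Y - Y) * ((P Y)^2 - K) / (2 * (V Y * (V Y - 1)))" if "Y \<in> S" for Y
  proof -
    have "2 * a / (b * e) * ((p * e / 2)^2 - K / 4 * e^2) = a * e * (p^2 - K) / (2 * b)"
      if "e \<noteq> 0" "b \<noteq> 0" for a b e p :: complex
      using that by (simp add: field_simps power2_eq_square)
    from this[of "V Y - Y" "V Y * (V Y - 1)" "Y - 1" "P Y"] show ?thesis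
      using S(3)[OF that] by (simp add: P_def hq_of_V_eq_momentum)
  qed
  \<comment> \<open>By the momentum equation \<open>2 * P * P'\<close> is \<open>W * Q\<close>, so
    \<open>Q\<close> acts as the logarithmic derivative of \<open>P^2 - K\<close>.\<close>
  define Q where "Q = P X * y / (2 * m * n)"
  have dW: "((\<lambda>Y. (P Y)^2 - K) has_field_derivative W * Q) (at X)"
  proof -
    have "2 * P X * (W * y / (4 * m * n)) = W * Q" by (simp add: Q_def mult_ac)
    then have "2 * P X * (((P X)^2 - K) * y / (4 * m * n)) = W * Q" by (simp add: W_def)
    moreover have "((\<lambda>Y. (P Y)^2 - K) has_field_derivative 2 * P X * (((P X)^2 - K) * y / (4 * m * n))) (at X)"
      by (rule derivative_eq_intros dP refl | simp)+
    ultimately show ?thesis by simp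
  qed
  have "((\<lambda>Y. (Y - 1) * (V Y - Y)) has_field_derivative e + (X - 1) * (V1 - 1)) (at X)"
    by (rule derivative_eq_intros dV refl | simp add: e_def)+
  from DERIV_mult[OF this dW]
  have num: "((\<lambda>Y. (Y - 1) * (V Y - Y) * ((P Y)^2 - K)) has_field_derivative
      (e + (X - 1) * (V1 - 1)) * W + W * Q * ((X - 1) * e)) (at X)"
    by (simp add: e_def W_def)
  have den: "((\<lambda>Y. 2 * (V Y * (V Y - 1))) has_field_derivative 2 * ((2 * V X - 1) * V1)) (at X)"
    by (rule derivative_eq_intros dV refl | simp add: algebra_simps)+
  have "((\<lambda>Y. (Y - 1) * (V Y - Y) * ((P Y)^2 - K) / (2 * (V Y * (V Y - 1)))) has_field_derivative
      (((e + (X - 1) * (V1 - 1)) * W + W * Q * ((X - 1) * e)) * (2 * n)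
        - (X - 1) * e * W * (2 * ((2 * V X - 1) * V1))) / ((2 * n) * (2 * n))) (at X)"
    using DERIV_divide[OF num den] nz(2) by (simp add: e_def n_def W_def)
  then have "(hq_of_V g K V has_field_derivative
      (((e + (X - 1) * (V1 - 1)) * W + W * Q * ((X - 1) * e)) * (2 * n)
        - (X - 1) * e * W * (2 * ((2 * V X - 1) * V1))) / ((2 * n) * (2 * n))) (at X)"
    by (rule has_field_derivative_transform_within_open[OF _ S(1) X]) (simp add: hq)
  moreover have "(((e + (X - 1) * (V1 - 1)) * W + W * Q * ((X - 1) * e)) * (2 * n)
        - (X - 1) * e * W * (2 * ((2 * V X - 1) * V1))) / ((2 * n) * (2 * n))
      = hq_of_V g K V X * (1 / (X - 1) + (V1 - 1) / e + P X * y / (2 * m * n) - (2 * V X - 1) * V1 / n)"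
  proof -
    have "(((e + x * (V1 - 1)) * W + W * Q * (x * e)) * (2 * n) - x * e * W * (2 * z)) / ((2 * n) * (2 * n))
        = x * e * W / (2 * n) * (1 / x + (V1 - 1) / e + Q - z / n)" if "x \<noteq> 0" for x z
      using that nz by (simp add: field_simps)
    from this[OF nz(5)] show ?thesis
      unfolding hq[OF X] e_def[symmetric] n_def[symmetric] W_def[symmetric] Q_def[symmetric] .
  qed
  moreover have "1 / (X - 1) + (V1 - 1) / e + P X * y / (2 * m * n) - (2 * V X - 1) * V1 / n
      = ((1 + g) / (2 * (X - 1)) - (1 - g) / (2 * e)) + (1 / (X - 1) - (1 + g) * V X / (2 * X * (X - 1)))"
  proof -
    have "P X * e = 2 * (m * V1 - s * n)"
      using nz by (simp add: P_def GC_momentum_def e_def m_def n_def s_def V1_def)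
    \<comment> \<open>Trading \<open>V'\<close> for \<open>P\<close> makes the terms in
      \<open>P\<close> cancel against \<open>Q\<close>; what is left is rational in
      \<open>X\<close>, \<open>V\<close> and \<open>s\<close>.\<close>
    then have V1: "V1 = P X * e / (2 * m) + s * n / m"
      using nz by (simp add: field_simps)
    have r1: "(2 * V X - 1) * e = n + y" and r2: "e^2 = y + m"
      by (simp_all add: n_def e_def y_def m_def power2_eq_square algebra_simps)
    have "V1 / e - (2 * V X - 1) * V1 / n = V1 * (n - (2 * V X - 1) * e) / (n * e)"
      using nz by (simp add: divide_simps) algebra
    also have "\<dots> = - (P X * y / (2 * m * n)) - s * y / (m * e)"
      unfolding r1 V1 by (simp add: nz divide_simps) algebra
    finally have 1: "V1 / e - (2 * V X - 1) * V1 / n = - (P X * y / (2 * m * n)) - s * y / (m * e)" .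
    have 2: "s / e + s * y / (m * e) = s * V X / m - s / (X - 1)"
    proof -
      have "s / e + s * y / (m * e) = s * (y + m) / (m * e)"
        using nz by (simp add: field_simps)
      also have "\<dots> = s * e / m"
        unfolding r2[symmetric] using nz by (simp add: power2_eq_square)
      also have "\<dots> = s * V X / m - s / (X - 1)"
      proof -
        have "s / (X - 1) = s * X / m" using nz by (simp add: m_def)
        then show ?thesis by (simp add: e_def right_diff_distrib diff_divide_distrib)
      qed
      finally show ?thesis .
    qed
    have g: "1 + g = 2 * s" "1 - g = 2 * (1 - s)" by (simp_all add: s_def field_simps)
    have "2 * s * V X / (2 * X * (X - 1)) = s * V X / m" by (simp add: m_def)
    moreover have "2 * s / (2 * (X - 1)) = s / (X - 1)" "2 * (1 - s) / (2 * e) = 1 / e - s / e"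
      unfolding diff_divide_distrib[symmetric] by (rule mult_divide_mult_cancel_left; simp)+
    ultimately show ?thesis
      unfolding g diff_divide_distrib using 1 2 by algebra
  qed
  ultimately show ?thesis unfolding e_def by (simp only:)
qed

text \<open>Fixing \<open>q\<close> first and taking \<open>h\<close> as a quotient makes the
  product formula exact, where two separate primitives would leave a constant to adjust. The
  logarithmic derivative of \<open>h\<close> then comes from
  \<open>has_field_derivative_hq_of_V\<close>, and \<open>v\<close> is solved from the relation with
  \<open>V\<close>.\<close>

lemma given_by_of_PVI:
  assumes pv: "PVI_function (((1 + g) / 2)^2) (K / 4) (K / 4) (((1 - g) / 2)^2) S V"
    and D: "open D" "simply_connected D" "D \<inter> {0, 1, -1} = {}" "Xmap ` D \<subseteq> S"
    and ne: "\<exists>\<eta>\<in>D. hq_of_V g K V (Xmap \<eta>) \<noteq> 0"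
  shows "\<exists>v h q. given_by g K V D v h q"
proof -
  have S: "open S" "V holomorphic_on S"
    "\<And>X. X \<in> S \<Longrightarrow> V X \<noteq> 0 \<and> V X \<noteq> 1 \<and> V X \<noteq> X \<and> X \<noteq> 0 \<and> X \<noteq> 1"
    using pv by (auto simp: PVI_function_def)
  have XS: "Xmap \<eta> \<in> S" if "\<eta> \<in> D" for \<eta> using D that by auto
  note dom = Xmap_domain[OF D(3)]
  have dX: "(Xmap has_field_derivative 2 * \<eta> * (Xmap \<eta>)^2) (at \<eta>)" if "\<eta> \<in> D" for \<eta>
    using has_field_derivative_Xmap[OF dom(2)[OF that]] .
  then have Xhol: "Xmap holomorphic_on D"
    using D(1) holomorphic_on_open by blast
  have comp: "(\<lambda>\<eta>. f (Xmap \<eta>)) holomorphic_on D" if "f holomorphic_on S" for f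
    using holomorphic_on_compose_gen[OF Xhol that D(4)] by (simp add: o_def)
  have conn: "connected D" and prim: "\<And>f. f holomorphic_on D \<Longrightarrow>
       \<exists>F. \<forall>z. z \<in> D \<longrightarrow> (F has_field_derivative f z) (at z)"
    using D(2) simply_connected_eq_global_primitive[OF D(1)] by auto
  define P where "P = GC_momentum g V"
  define A where "A = (\<lambda>X. ((V X)^2 - 2 * X * V X + X) / (4 * (X * (X - 1)) * (V X * (V X - 1))))"
  have dP: "(P has_field_derivative ((P X)^2 - K) * A X) (at X)" if "X \<in> S" for X
    using PVI_momentum_equation[OF pv that] by (simp add: P_def A_def)
  then have Phol: "P holomorphic_on S"
    using S(1) holomorphic_on_open by blast
  have Ahol: "A holomorphic_on S"
    unfolding A_def using S by (intro holomorphic_intros) auto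
  define W where "W = (\<lambda>\<eta>. (P (Xmap \<eta>))^2 - K)"
  \<comment> \<open>The coefficient in \<open>W' = b * W\<close>, with the derivative taken in
    \<open>\<eta>\<close>.\<close>
  define b where "b = (\<lambda>\<eta>. 2 * P (Xmap \<eta>) * A (Xmap \<eta>) * (2 * \<eta> * (Xmap \<eta>)^2))"
  have "b holomorphic_on D"
    unfolding b_def by (intro holomorphic_intros comp Phol Ahol Xhol)
  then obtain \<beta> where \<beta>: "\<And>z. z \<in> D \<Longrightarrow> (\<beta> has_field_derivative b z) (at z)"
    using prim by blast
  have dW: "(W has_field_derivative b \<eta> * W \<eta>) (at \<eta>)" if "\<eta> \<in> D" for \<eta>
  proof -
    note d = DERIV_chain2[OF dP[OF XS[OF that]] dX[OF that]]
    show ?thesis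
      unfolding W_def b_def by (rule derivative_eq_intros d refl | simp)+
  qed
  \<comment> \<open>An integrating factor: \<open>E\<close> is constant on the connected set
    \<open>D\<close>, so \<open>W\<close> vanishes everywhere or nowhere, and \<open>ne\<close>
    excludes the former.\<close>
  define E where "E = (\<lambda>\<eta>. W \<eta> * exp (- \<beta> \<eta>))"
  have dE: "(E has_field_derivative 0) (at \<eta>)" if "\<eta> \<in> D" for \<eta>
    unfolding E_def by (rule derivative_eq_intros dW \<beta> that refl | simp)+
  then have "continuous_on D E"
    by (intro continuous_at_imp_continuous_on ballI DERIV_isCont)
  then obtain c where c: "\<And>\<eta>. \<eta> \<in> D \<Longrightarrow> W \<eta> * exp (- \<beta> \<eta>) = c"
    using DERIV_zero_connected_constant[OF conn D(1), of "{}" E] dE unfolding E_def by auto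
  define H where "H = hq_of_V g K V"
  \<comment> \<open>The two differ by a factor without zeros on \<open>D\<close>.\<close>
  have HW: "H (Xmap \<eta>) \<noteq> 0 \<longleftrightarrow> W \<eta> \<noteq> 0" if "\<eta> \<in> D" for \<eta>
  proof -
    note s = S(3)[OF XS[OF that]]
    have eq: "(P (Xmap \<eta>) * e / 2)^2 - K / 4 * e^2 = W \<eta> * e^2 / 4" for e
      by (simp add: W_def field_simps)
    have "V (Xmap \<eta>) \<noteq> Xmap \<eta>" using s by blast
    then have "H (Xmap \<eta>) = 2 * (Xmap \<eta> - 1) / (V (Xmap \<eta>) * (V (Xmap \<eta>) - 1) * (V (Xmap \<eta>) - Xmap \<eta>))
        * (W \<eta> * (V (Xmap \<eta>) - Xmap \<eta>)^2 / 4)"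
      unfolding H_def eq[symmetric] P_def by (rule hq_of_V_eq_momentum)
    then show ?thesis using s by simp
  qed
  then obtain \<eta>1 where \<eta>1: "\<eta>1 \<in> D" "W \<eta>1 \<noteq> 0" using ne by (auto simp: H_def)
  have "c \<noteq> 0" using c[OF \<eta>1(1)] \<eta>1(2) by auto
  then have H0: "H (Xmap \<eta>) \<noteq> 0" if "\<eta> \<in> D" for \<eta>
    using HW[OF that] c[OF that] by auto
  define lh lq where "lh = (\<lambda>X. (1 + g) / (2 * (X - 1)) - (1 - g) / (2 * (V X - X)))"
    and "lq = (\<lambda>X. 1 / (X - 1) - (1 + g) * V X / (2 * X * (X - 1)))"
  have lqhol: "lq holomorphic_on S"
    unfolding lq_def using S by (intro holomorphic_intros) auto
  have "(\<lambda>\<eta>. lq (Xmap \<eta>) * (2 * \<eta> * (Xmap \<eta>)^2)) holomorphic_on D"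
    by (intro holomorphic_intros comp lqhol Xhol)
  then obtain \<phi> where \<phi>: "\<And>z. z \<in> D \<Longrightarrow> (\<phi> has_field_derivative lq (Xmap z) * (2 * z * (Xmap z)^2)) (at z)"
    using prim by blast
  define q h v where "q = (\<lambda>\<eta>. exp (\<phi> \<eta>))" and "h = (\<lambda>\<eta>. H (Xmap \<eta>) / q \<eta>)"
    and "v = (\<lambda>\<eta>. 2 * q \<eta> * (V (Xmap \<eta>) - Xmap \<eta>) / (\<eta> * h \<eta> * Xmap \<eta>))"
  have q0: "q \<eta> \<noteq> 0" for \<eta> by (simp add: q_def)
  have h0: "h \<eta> \<noteq> 0" if "\<eta> \<in> D" for \<eta> using H0[OF that] q0 by (simp add: h_def)
  have v0: "v \<eta> \<noteq> 0" if "\<eta> \<in> D" for \<eta>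
    using S(3)[OF XS[OF that]] q0 h0[OF that] dom[OF that] by (simp add: v_def)
  have dq: "(q has_field_derivative q \<eta> * lq (Xmap \<eta>) * (2 * \<eta> * (Xmap \<eta>)^2)) (at \<eta>)" if "\<eta> \<in> D" for \<eta>
    unfolding q_def by (rule derivative_eq_intros \<phi> that refl | simp)+
  have dh: "(h has_field_derivative h \<eta> * lh (Xmap \<eta>) * (2 * \<eta> * (Xmap \<eta>)^2)) (at \<eta>)" if "\<eta> \<in> D" for \<eta>
  proof -
    have "(H has_field_derivative H (Xmap \<eta>) * (lh (Xmap \<eta>) + lq (Xmap \<eta>))) (at (Xmap \<eta>))"
      unfolding H_def lh_def lq_def by (rule has_field_derivative_hq_of_V[OF pv XS[OF that]])
    note d = DERIV_chain2[OF this dX[OF that]]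
    show ?thesis
      unfolding h_def
      by (rule derivative_eq_intros d dq that refl | use q0 in \<open>simp add: field_simps\<close>)+
  qed
  have hol: "q holomorphic_on D" "h holomorphic_on D"
    using dq dh D(1) holomorphic_on_open by blast+
  have "v holomorphic_on D"
    unfolding v_def using h0 dom S XS
    by (intro holomorphic_intros hol comp Xhol S(2)) auto
  moreover have "\<eta> * h \<eta> * v \<eta> / (2 * q \<eta>) = (V (Xmap \<eta>) - Xmap \<eta>) / Xmap \<eta>" if "\<eta> \<in> D" for \<eta>
    using h0[OF that] q0[of \<eta>] dom[OF that] S(3)[OF XS[OF that]] by (simp add: v_def)
  moreover have "dlog_dX h \<eta> = lh (Xmap \<eta>)" "dlog_dX q \<eta> = lq (Xmap \<eta>)" if "\<eta> \<in> D" for \<eta>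
    using DERIV_imp_deriv[OF dh[OF that]] DERIV_imp_deriv[OF dq[OF that]] deriv_Xmap[OF dom(2)[OF that]]
      h0[OF that] q0[of \<eta>] dom[OF that] S(3)[OF XS[OF that]] by (simp_all add: dlog_dX_def)
  moreover have "h \<eta> * q \<eta> = H (Xmap \<eta>)" for \<eta>
    using q0[of \<eta>] by (simp add: h_def)
  ultimately have "given_by g K V D v h q"
    unfolding given_by_def Let_def using hol v0 h0 q0 by (simp add: lh_def lq_def H_def)
  then show ?thesis by blast
qed

text \<open>Being the general solution is read as a correspondence in both directions, together with
  existence in the last clause. If \<open>h\<close> and \<open>q\<close> both vanish identically,
  the relation defining \<open>V\<close> is void, which explains the exclusion in the second clause;
  injectivity of \<open>Xmap\<close> there makes \<open>V\<close> a single-valued function of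
  \<open>X\<close>. The last clause asks for a nonzero value of \<open>hq_of_V\<close> because
  \<open>given_by\<close> demands that \<open>h\<close> and \<open>q\<close> have no zeros.\<close>

theorem mainTheorem1:
  fixes g :: complex
  assumes g: "g^2 \<noteq> 1"
  shows
    "(\<forall>D v h q. connected D \<and> reduced_GC_solution g D v h q \<longrightarrow>
        (\<exists>K. \<forall>\<eta>\<in>D. first_integral g v h q \<eta> = K))
   \<and>
     (\<forall>D v h q K.
        connected D \<and> D \<inter> {0, 1, -1} = {} \<and> inj_on Xmap D \<and>
        reduced_GC_solution g D v h q \<and> (\<forall>\<eta>\<in>D. first_integral g v h q \<eta> = K) \<and>
        (\<exists>\<eta>\<in>D. h \<eta> \<noteq> 0 \<or> q \<eta> \<noteq> 0) \<longrightarrow>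
        (\<exists>V Z. Z \<subseteq> D \<and> Z sparse_in D \<and>
           PVI_function (((1 + g) / 2)^2) (K / 4) (K / 4) (((1 - g) / 2)^2) (Xmap ` (D - Z)) V \<and>
           given_by g K V (D - Z) v h q))
   \<and>
     (\<forall>K S V D v h q.
        PVI_function (((1 + g) / 2)^2) (K / 4) (K / 4) (((1 - g) / 2)^2) S V \<and>
        open D \<and> D \<inter> {0, 1, -1} = {} \<and> Xmap ` D \<subseteq> S \<and> given_by g K V D v h q \<longrightarrow>
        reduced_GC_solution g D v h q \<and> (\<forall>\<eta>\<in>D. first_integral g v h q \<eta> = K))
   \<and>
     (\<forall>K S V D.
        PVI_function (((1 + g) / 2)^2) (K / 4) (K / 4) (((1 - g) / 2)^2) S V \<and>
        open D \<and> simply_connected D \<and> D \<inter> {0, 1, -1} = {} \<and> Xmap ` D \<subseteq> S \<and>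
        (\<exists>\<eta>\<in>D. hq_of_V g K V (Xmap \<eta>) \<noteq> 0) \<longrightarrow>
        (\<exists>v h q. given_by g K V D v h q))"
proof (intro conjI allI impI; elim conjE)
  show "\<exists>K. \<forall>\<eta>\<in>D. first_integral g v h q \<eta> = K"
    if "connected D" "reduced_GC_solution g D v h q" for D v h q
    using first_integral_constant[OF that] .
next
  show "\<exists>V Z. Z \<subseteq> D \<and> Z sparse_in D \<and>
           PVI_function (((1 + g) / 2)^2) (K / 4) (K / 4) (((1 - g) / 2)^2) (Xmap ` (D - Z)) V \<and>
           given_by g K V (D - Z) v h q"
    if "connected D" "D \<inter> {0, 1, -1} = {}" "inj_on Xmap D" "reduced_GC_solution g D v h q"
      "\<forall>\<eta>\<in>D. first_integral g v h q \<eta> = K" "\<exists>\<eta>\<in>D. h \<eta> \<noteq> 0 \<or> q \<eta> \<noteq> 0" for D v h q K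
    using PVI_of_reduced_GC_solution[OF g that] .
next
  fix K S V D v h q
  assume *: "PVI_function (((1 + g) / 2)^2) (K / 4) (K / 4) (((1 - g) / 2)^2) S V"
    "open D" "D \<inter> {0, 1, -1} = {}" "Xmap ` D \<subseteq> S" "given_by g K V D v h q"
  show "reduced_GC_solution g D v h q" "\<forall>\<eta>\<in>D. first_integral g v h q \<eta> = K"
    using reduced_GC_solution_of_PVI[OF *] by auto
next
  show "\<exists>v h q. given_by g K V D v h q"
    if "PVI_function (((1 + g) / 2)^2) (K / 4) (K / 4) (((1 - g) / 2)^2) S V" "open D"
      "simply_connected D" "D \<inter> {0, 1, -1} = {}" "Xmap ` D \<subseteq> S"
      "\<exists>\<eta>\<in>D. hq_of_V g K V (Xmap \<eta>) \<noteq> 0" for K S V D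
    using given_by_of_PVI[OF that] .
qed

end
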